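(* Let $K$ be a field complete with respect to a discrete valuation, of characteristic $2$, with perfect residue field. Let $L/K$ be a totally ramified Galois extension with $G=\mathrm{Gal}(L/K)\cong C_2\times C_2$, with lower ramification breaks $b_1\le b_2$. Let $h\in\mathbb{Z}$ and let $\mathfrak{A}=\{\alpha\in K[G]:\alpha\cdot\mathfrak{P}_L^h\subseteq\mathfrak{P}_L^h\}$ be the associated order of $\mathfrak{P}_L^h$. Then $\mathfrak{P}_L^h$ is free over $\mathfrak{A}$ if and only if either $b_1\equiv1\pmod4$ and $h\not\equiv2\pmod4$, or $b_1\equiv3\pmod4$ and $h\not\equiv1\pmod4$. In the cases where $\mathfrak{P}_L^h$ is not free, it requires $3$ generators over $\mathfrak{A}$. The embedding dimension $\dim_\kappa(\mathfrak{M}/\mathfrak{M}^2)$ of $\mathfrak{A}$ (with $\mathfrak{M}$ its unique maximal ideal and $\kappa$ the residue field of $K$) is $3$ if $b_1\equiv1\pmod4$ and $h\equiv1\pmod2$, or $b_1\equiv3\pmod4$ and $h\equiv0\pmod2$, and is $4$ otherwise.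
   Context: $v_L$ is the normalized valuation of $L$, $\mathfrak{O}_L$ its valuation ring and $\mathfrak{P}_L$ the maximal ideal; $G$ acts on $L$ and hence $K[G]$ acts on $L$ in the usual way. The ramification groups are $G_j=\{\sigma\in G:(\sigma-1)\mathfrak{O}_L\subseteq\mathfrak{P}_L^{j+1}\}$ and the lower ramification breaks counted with multiplicity are $b_i=\max\{j:|G_j|>2^{2-i}\}$ for $i=1,2$. *)

theory Defs
  imports Main
begin

text \<open>Setting. The top field L is the ambient type 'a. A normalized discrete
valuation on L is a map v on the nonzero elements (the value at 0 is irrelevant,
0 is treated as having valuation +infinity).\<close>

definition Pideal :: "('a::field \<Rightarrow> int) \<Rightarrow> int \<Rightarrow> 'a set" where
  "Pideal v h = {x. x = 0 \<or> h \<le> v x}"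

definition normalized_dval :: "('a::field \<Rightarrow> int) \<Rightarrow> bool" where
  "normalized_dval v \<longleftrightarrow>
     (\<forall>x y. x \<noteq> 0 \<longrightarrow> y \<noteq> 0 \<longrightarrow> v (x * y) = v x + v y) \<and>
     (\<forall>x y. x \<noteq> 0 \<longrightarrow> y \<noteq> 0 \<longrightarrow> x + y \<noteq> 0 \<longrightarrow> min (v x) (v y) \<le> v (x + y)) \<and>
     (\<exists>x. x \<noteq> 0 \<and> v x = 1)"

definition subfield :: "'a::field set \<Rightarrow> bool" where
  "subfield K \<longleftrightarrow> 0 \<in> K \<and> 1 \<in> K \<and>
     (\<forall>x\<in>K. \<forall>y\<in>K. x + y \<in> K \<and> x - y \<in> K \<and> x * y \<in> K) \<and>
     (\<forall>x\<in>K. inverse x \<in> K)"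

definition complete_in :: "('a::field \<Rightarrow> int) \<Rightarrow> 'a set \<Rightarrow> bool" where
  "complete_in v K \<longleftrightarrow>
     (\<forall>s::nat \<Rightarrow> 'a. (\<forall>n. s n \<in> K) \<longrightarrow>
        (\<forall>N. \<exists>M. \<forall>m\<ge>M. \<forall>n\<ge>M. s m - s n \<in> Pideal v N) \<longrightarrow>
        (\<exists>y\<in>K. \<forall>N. \<exists>M. \<forall>n\<ge>M. s n - y \<in> Pideal v N))"

definition perfect_residue_char2 :: "('a::field \<Rightarrow> int) \<Rightarrow> 'a set \<Rightarrow> bool" where
  "perfect_residue_char2 v K \<longleftrightarrow>
     (\<forall>x\<in>K \<inter> Pideal v 0. \<exists>y\<in>K \<inter> Pideal v 0. x - y * y \<in> Pideal v 1)"

definition field_aut :: "('a::field \<Rightarrow> 'a) \<Rightarrow> bool" where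
  "field_aut \<sigma> \<longleftrightarrow> bij \<sigma> \<and> (\<forall>x y. \<sigma> (x + y) = \<sigma> x + \<sigma> y \<and> \<sigma> (x * y) = \<sigma> x * \<sigma> y)"

definition galois_with_group :: "'a::field set \<Rightarrow> ('a \<Rightarrow> 'a) set \<Rightarrow> bool" where
  "galois_with_group K G \<longleftrightarrow>
     G = {\<sigma>. field_aut \<sigma> \<and> (\<forall>x\<in>K. \<sigma> x = x)} \<and> finite G \<and>
     {x. \<forall>\<sigma>\<in>G. \<sigma> x = x} = K"

definition klein4 :: "('a \<Rightarrow> 'a) set \<Rightarrow> bool" where
  "klein4 G \<longleftrightarrow> card G = 4 \<and> (\<forall>\<sigma>\<in>G. \<sigma> \<circ> \<sigma> = id)"

text \<open>Totally ramified (ramification index 4 = [L:K]): v(K^*) = 4Z.\<close>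
definition totally_ramified4 :: "('a::field \<Rightarrow> int) \<Rightarrow> 'a set \<Rightarrow> bool" where
  "totally_ramified4 v K \<longleftrightarrow> v ` (K - {0}) = {n. 4 dvd n}"

definition ramgrp :: "('a::field \<Rightarrow> int) \<Rightarrow> ('a \<Rightarrow> 'a) set \<Rightarrow> int \<Rightarrow> ('a \<Rightarrow> 'a) set" where
  "ramgrp v G j = {\<sigma>\<in>G. \<forall>x\<in>Pideal v 0. \<sigma> x - x \<in> Pideal v (j + 1)}"

definition lower_break :: "('a::field \<Rightarrow> int) \<Rightarrow> ('a \<Rightarrow> 'a) set \<Rightarrow> nat \<Rightarrow> int" where
  "lower_break v G i = (GREATEST j. card (ramgrp v G j) > 2 ^ (2 - i))"

definition grpalg :: "'a::field set \<Rightarrow> ('a \<Rightarrow> 'a) set \<Rightarrow> (('a \<Rightarrow> 'a) \<Rightarrow> 'a) set" where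
  "grpalg K G = {\<alpha>. (\<forall>\<sigma>\<in>G. \<alpha> \<sigma> \<in> K) \<and> (\<forall>\<sigma>. \<sigma> \<notin> G \<longrightarrow> \<alpha> \<sigma> = 0)}"

definition ga_act :: "('a \<Rightarrow> 'a) set \<Rightarrow> (('a \<Rightarrow> 'a) \<Rightarrow> 'a) \<Rightarrow> 'a \<Rightarrow> 'a::field" where
  "ga_act G \<alpha> x = (\<Sum>\<sigma>\<in>G. \<alpha> \<sigma> * \<sigma> x)"

definition ga_mult :: "('a \<Rightarrow> 'a) set \<Rightarrow> (('a \<Rightarrow> 'a) \<Rightarrow> 'a) \<Rightarrow> (('a \<Rightarrow> 'a) \<Rightarrow> 'a)
                        \<Rightarrow> (('a \<Rightarrow> 'a) \<Rightarrow> 'a::field)" where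
  "ga_mult G \<alpha> \<beta> = (\<lambda>\<tau>. \<Sum>\<sigma>\<in>G. \<Sum>\<rho>\<in>G. if \<sigma> \<circ> \<rho> = \<tau> then \<alpha> \<sigma> * \<beta> \<rho> else 0)"

definition assoc_order :: "'a::field set \<Rightarrow> ('a \<Rightarrow> int) \<Rightarrow> ('a \<Rightarrow> 'a) set \<Rightarrow> int
                           \<Rightarrow> (('a \<Rightarrow> 'a) \<Rightarrow> 'a) set" where
  "assoc_order K v G h =
     {\<alpha>\<in>grpalg K G. \<forall>x\<in>Pideal v h. ga_act G \<alpha> x \<in> Pideal v h}"

definition generated_by :: "('a \<Rightarrow> 'a) set \<Rightarrow> (('a \<Rightarrow> 'a) \<Rightarrow> 'a) set \<Rightarrow> 'a::field set
                            \<Rightarrow> 'a list \<Rightarrow> bool" where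
  "generated_by G A N xs \<longleftrightarrow> set xs \<subseteq> N \<and>
     N = {\<Sum>i<length xs. ga_act G (as i) (xs ! i) | as. \<forall>i<length xs. as i \<in> A}"

definition free_over :: "('a \<Rightarrow> 'a) set \<Rightarrow> (('a \<Rightarrow> 'a) \<Rightarrow> 'a) set \<Rightarrow> 'a::field set \<Rightarrow> bool" where
  "free_over G A N \<longleftrightarrow> (\<exists>xs. generated_by G A N xs \<and>
     (\<forall>as. (\<forall>i<length xs. as i \<in> A) \<longrightarrow>
        (\<Sum>i<length xs. ga_act G (as i) (xs ! i)) = 0 \<longrightarrow>
        (\<forall>i<length xs. as i = (\<lambda>_. 0))))"

definition min_gens :: "('a \<Rightarrow> 'a) set \<Rightarrow> (('a \<Rightarrow> 'a) \<Rightarrow> 'a) set \<Rightarrow> 'a::field set \<Rightarrow> nat" where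
  "min_gens G A N = (LEAST n. \<exists>xs. length xs = n \<and> generated_by G A N xs)"

definition ga_ideal :: "('a \<Rightarrow> 'a) set \<Rightarrow> (('a \<Rightarrow> 'a) \<Rightarrow> 'a) set \<Rightarrow> (('a \<Rightarrow> 'a) \<Rightarrow> 'a::field) set
                        \<Rightarrow> bool" where
  "ga_ideal G A I \<longleftrightarrow> I \<subseteq> A \<and> (\<lambda>_. 0) \<in> I \<and>
     (\<forall>x\<in>I. \<forall>y\<in>I. (\<lambda>\<sigma>. x \<sigma> + y \<sigma>) \<in> I) \<and>
     (\<forall>a\<in>A. \<forall>x\<in>I. ga_mult G a x \<in> I)"

definition ga_maximal_ideal :: "('a \<Rightarrow> 'a) set \<Rightarrow> (('a \<Rightarrow> 'a) \<Rightarrow> 'a) set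
                                \<Rightarrow> (('a \<Rightarrow> 'a) \<Rightarrow> 'a::field) set \<Rightarrow> bool" where
  "ga_maximal_ideal G A I \<longleftrightarrow> ga_ideal G A I \<and> I \<noteq> A \<and>
     (\<forall>J. ga_ideal G A J \<longrightarrow> I \<subseteq> J \<longrightarrow> J = I \<or> J = A)"

definition the_max_ideal :: "('a \<Rightarrow> 'a) set \<Rightarrow> (('a \<Rightarrow> 'a) \<Rightarrow> 'a) set
                             \<Rightarrow> (('a \<Rightarrow> 'a) \<Rightarrow> 'a::field) set" where
  "the_max_ideal G A = (THE I. ga_maximal_ideal G A I)"

definition ideal_square :: "('a \<Rightarrow> 'a) set \<Rightarrow> (('a \<Rightarrow> 'a) \<Rightarrow> 'a) set
                            \<Rightarrow> (('a \<Rightarrow> 'a) \<Rightarrow> 'a::field) set" where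
  "ideal_square G M = {(\<lambda>\<tau>. \<Sum>i<n. ga_mult G (a i) (b i) \<tau>) | (n::nat) a b. \<forall>i<n. a i \<in> M \<and> b i \<in> M}"

text \<open>Embedding dimension dim_kappa (M/M^2): the dimension of M/M^2 as a vector
space over kappa = O_K/P_K (acting through O_K inside A), i.e. the least size of a
spanning family of M/M^2.\<close>
definition emb_dim :: "'a::field set \<Rightarrow> ('a \<Rightarrow> int) \<Rightarrow> ('a \<Rightarrow> 'a) set \<Rightarrow> (('a \<Rightarrow> 'a) \<Rightarrow> 'a) set
                       \<Rightarrow> nat" where
  "emb_dim K v G A = (let M = the_max_ideal G A; M2 = ideal_square G M in
     (LEAST n. \<exists>ms::nat \<Rightarrow> (('a \<Rightarrow> 'a) \<Rightarrow> 'a). (\<forall>i<n. ms i \<in> M) \<and>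
        (\<forall>m\<in>M. \<exists>c. (\<forall>i<n. c i \<in> K \<inter> Pideal v 0) \<and>
            (\<lambda>\<sigma>. m \<sigma> - (\<Sum>i<n. c i * ms i \<sigma>)) \<in> M2)))"

end

(* Pick tau in G with minimal ramification break b1 and let M be its fixed field. Artin-Schreier
   generators x1 of M/K and x2 of L/M of maximal valuation have v x1 = 2 (mod 4) and v x2 = -b1, so
   1, x1, x2, x1 x2 have distinct valuations mod 4. Suitable Psi1, Psi2 in the augmentation ideal of
   K[G] act on this basis as d/dx1 and d/dx2. Hence P_L^h and its associated order are both spanned
   by monomials, and everything depends on the exponents A, B, C, D = ceil((h - v e)/4) for the four
   basis elements e: with E = A + D - B - C the ideal is free iff E <= 0, it needs three generators
   (the ones at x1 x2, x1 and x2) if E > 0, and the generator of the order in K Psi1 Psi2 lies in the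
   square of the maximal ideal iff E = 0. *)

theory Submission
  imports Defs
begin

section \<open>Valuations in characteristic two\<close>

text \<open>Nothing in the hypotheses says that the Galois automorphisms preserve \<open>v\<close>;
  completeness has to force it. If an involution \<open>s\<close> lowered some valuation,
  \<open>y = x / s x\<close> would have norm 1 and positive valuation. Its quadratic equation over
  the fixed field, scaled by the inverse \<open>r\<close> of its trace, becomes the Artin-Schreier
  equation \<open>Z + Z^2 = r^2\<close> with \<open>r\<close> in the maximal ideal. Completeness
  puts a root into the fixed field, so \<open>y\<close> lies there too, which is absurd. Isometry
  also passes completeness from K up to M, so one locale serves both layers of the tower. Origin of
  E: \<open>\<Psi>1\<close> sends x1 to 1 and x1 x2 to x2, so a multiple \<open>k \<Psi>1\<close>
  preserves the ideal exactly when the valuation of \<open>k\<close> in K is at least A - B and at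
  least C - D. E is the difference of these two bounds, and also of the bounds A - C and B - D for
  \<open>\<Psi>2\<close>. The lower bounds for the number of generators and for the embedding
  dimension share one argument: a matrix congruent to the identity modulo the maximal ideal cannot
  factor through fewer columns.\<close>

locale dval2 =
  fixes v :: "'a::field \<Rightarrow> int"
  assumes char2 [simp]: "(2::'a) = 0"
    and val: "normalized_dval v"
begin

lemma add_self [simp]: "x + x = (0::'a)"
proof -
  have "x + x = 2 * x" by (simp only: mult_2)
  then show ?thesis using char2 by simp
qed

lemma uminus_eq [simp]: "- x = (x::'a)"
  by (rule minus_unique) simp

lemma diff_eq [simp]: "x - y = x + (y::'a)"
  by (simp only: diff_conv_add_uminus uminus_eq)

lemma add_self2 [simp]: "x + (x + y) = (y::'a)"
  by (simp add: add.assoc[symmetric])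

lemma add_eq_0 [simp]: "x + y = 0 \<longleftrightarrow> x = (y::'a)"
  by (metis add_self2 add.right_neutral add_self)

lemma v_mult: "x \<noteq> 0 \<Longrightarrow> y \<noteq> 0 \<Longrightarrow> v (x * y) = v x + v y"
  using val by (simp add: normalized_dval_def)

lemma v_add: "x \<noteq> 0 \<Longrightarrow> y \<noteq> 0 \<Longrightarrow> x + y \<noteq> 0 \<Longrightarrow> min (v x) (v y) \<le> v (x + y)"
  using val by (simp add: normalized_dval_def)

lemma v_1 [simp]: "v 1 = 0"
  using v_mult[of 1 1] by simp

lemma v_inverse: "x \<noteq> 0 \<Longrightarrow> v (inverse x) = - v x"
  using v_mult[of x "inverse x"] by simp

lemma v_divide: "x \<noteq> 0 \<Longrightarrow> y \<noteq> 0 \<Longrightarrow> v (x / y) = v x - v y"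
  by (simp add: divide_inverse v_mult v_inverse)

abbreviation P :: "int \<Rightarrow> 'a set" where "P \<equiv> Pideal v"

lemma P_0 [simp]: "0 \<in> P n"
  by (simp add: Pideal_def)

lemma P_iff: "x \<noteq> 0 \<Longrightarrow> x \<in> P n \<longleftrightarrow> n \<le> v x"
  by (simp add: Pideal_def)

lemma P_add [intro]: "x \<in> P n \<Longrightarrow> y \<in> P n \<Longrightarrow> x + y \<in> P n"
  using v_add[of x y] by (cases "x = 0"; cases "y = 0"; cases "x + y = 0")
    (auto simp: Pideal_def simp del: add_eq_0)

lemma P_add_left: "x \<in> P n \<Longrightarrow> x + y \<in> P n \<longleftrightarrow> y \<in> P n"
  using P_add[of x n y] P_add[of x n "x + y"] by auto

lemma P_add_right: "y \<in> P n \<Longrightarrow> x + y \<in> P n \<longleftrightarrow> x \<in> P n"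
  using P_add_left[of y n x] by (simp add: add.commute)

lemma P_mult: "x \<in> P m \<Longrightarrow> y \<in> P n \<Longrightarrow> x * y \<in> P (m + n)"
  by (cases "x = 0"; cases "y = 0") (auto simp: Pideal_def v_mult)

lemma P_mono: "x \<in> P m \<Longrightarrow> n \<le> m \<Longrightarrow> x \<in> P n"
  by (auto simp: Pideal_def)

lemma P_sum: "(\<And>i. i \<in> I \<Longrightarrow> f i \<in> P n) \<Longrightarrow> sum f I \<in> P n"
  by (induction I rule: infinite_finite_induct) auto

lemma P_all_0: "(\<And>n. x \<in> P n) \<Longrightarrow> x = 0"
  using P_iff[of x "v x + 1"] by auto

lemma v_add_eq: "x \<noteq> 0 \<Longrightarrow> y \<noteq> 0 \<Longrightarrow> v x < v y \<Longrightarrow> v (x + y) = v x"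
  using v_add[of x y] v_add[of "x + y" y] by (cases "x = y") (auto simp: add.assoc)

section \<open>Linear algebra: ranks read off modulo the maximal ideal\<close>

lemma homogeneous_system:
  fixes m :: "nat \<Rightarrow> nat \<Rightarrow> 'a"
  assumes "finite S" "n < card S"
  shows "\<exists>z. (\<exists>l\<in>S. z l \<noteq> 0) \<and> (\<forall>i<n. (\<Sum>l\<in>S. m i l * z l) = 0)"
  using assms
proof (induction n arbitrary: S m)
  case 0
  then obtain l where "l \<in> S" by fastforce
  then show ?case by (intro exI[of _ "\<lambda>_. 1"]) auto
next
  case (Suc n)
  show ?case
  proof (cases "\<forall>l\<in>S. m n l = 0")
    case True
    have "n < card S" using Suc.prems by simp
    from Suc.IH[OF Suc.prems(1) this, of m] obtain z where
      z: "\<exists>l\<in>S. z l \<noteq> 0" "\<forall>i<n. (\<Sum>l\<in>S. m i l * z l) = 0" by blast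
    have "(\<Sum>l\<in>S. m n l * z l) = 0" using True by simp
    with z show ?thesis by (auto simp: less_Suc_eq)
  next
    case False
    then obtain k where k: "k \<in> S" "m n k \<noteq> 0" by blast
    let ?S = "S - {k}"
    \<comment> \<open>Gaussian elimination with pivot \<open>m n k\<close>; equation
      \<open>n\<close> is afterwards solved for the unknown \<open>k\<close>. Characteristic two
      absorbs the signs.\<close>
    let ?m = "\<lambda>i l. m i l + m i k * m n l / m n k"
    have "n < card ?S" using Suc.prems k by (simp add: card_Diff_singleton)
    from Suc.IH[OF _ this, of ?m] Suc.prems obtain z where
      z: "\<exists>l\<in>?S. z l \<noteq> 0" "\<forall>i<n. (\<Sum>l\<in>?S. ?m i l * z l) = 0" by auto
    define y where "y = z(k := (\<Sum>l\<in>?S. m n l * z l) / m n k)"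
    have y: "(\<Sum>l\<in>S. m i l * y l) = m i k * y k + (\<Sum>l\<in>?S. m i l * z l)" for i
    proof -
      have "(\<Sum>l\<in>S. m i l * y l) = m i k * y k + (\<Sum>l\<in>?S. m i l * y l)"
        using Suc.prems k by (simp add: sum.remove)
      also have "(\<Sum>l\<in>?S. m i l * y l) = (\<Sum>l\<in>?S. m i l * z l)"
        by (rule sum.cong) (auto simp: y_def)
      finally show ?thesis .
    qed
    have "(\<Sum>l\<in>S. m i l * y l) = 0" if "i < Suc n" for i
    proof (cases "i = n")
      case True
      then show ?thesis using k by (simp only: y) (simp add: y_def)
    next
      case False
      with that z have "(\<Sum>l\<in>?S. ?m i l * z l) = 0" by simp
      also have "(\<Sum>l\<in>?S. ?m i l * z l) = (\<Sum>l\<in>?S. m i l * z l) + m i k * y k"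
        by (simp add: y_def sum.distrib sum_distrib_left sum_divide_distrib algebra_simps)
      finally show ?thesis by (simp only: y) (simp add: add.commute)
    qed
    moreover have "\<exists>l\<in>S. y l \<noteq> 0" using z by (auto simp: y_def)
    ultimately show ?thesis by blast
  qed
qed

text \<open>If \<open>n < d\<close>, a kernel vector of \<open>f\<close> contradicts the dominance of the diagonal of \<open>c f\<close>
  at its entry of least valuation.\<close>

lemma residue_rank_le:
  fixes c f :: "nat \<Rightarrow> nat \<Rightarrow> 'a"
  assumes "\<And>j l. j < d \<Longrightarrow> l < d \<Longrightarrow>
      (\<Sum>i<n. c j i * f i l) + (if j = l then 1 else 0) \<in> P 1"
  shows "d \<le> n"
proof (rule ccontr)
  assume "\<not> d \<le> n"
  then obtain z where z: "\<exists>l\<in>{..<d}. z l \<noteq> 0" "\<forall>i<n. (\<Sum>l<d. f i l * z l) = 0"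
    using homogeneous_system[of "{..<d}" n f] by auto
  define Z where "Z = {l. l < d \<and> z l \<noteq> 0}"
  have "finite Z" "Z \<noteq> {}" using z by (auto simp: Z_def)
  then obtain j where j: "j \<in> Z" "\<And>l. l \<in> Z \<Longrightarrow> v (z j) \<le> v (z l)"
    using arg_min_if_finite(1)[of Z "\<lambda>l. v (z l)"] arg_min_least[of Z _ "\<lambda>l. v (z l)"] by blast
  have jd: "j < d" "z j \<noteq> 0" using j by (auto simp: Z_def)
  have "((\<Sum>i<n. c j i * f i l) + (if j = l then 1 else 0)) * z l \<in> P (1 + v (z j))"
    if "l < d" for l
    using j that by (intro P_mult assms jd) (auto simp: Pideal_def Z_def)
  then have "(\<Sum>l<d. ((\<Sum>i<n. c j i * f i l) + (if j = l then 1 else 0)) * z l) \<in> P (1 + v (z j))"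
    by (intro P_sum) auto
  also have "(\<Sum>l<d. ((\<Sum>i<n. c j i * f i l) + (if j = l then 1 else 0)) * z l) =
      (\<Sum>l<d. \<Sum>i<n. c j i * (f i l * z l)) + (\<Sum>l<d. if j = l then z l else 0)"
    unfolding sum.distrib[symmetric]
    by (rule sum.cong) (simp_all add: distrib_right sum_distrib_right mult.assoc)
  also have "(\<Sum>l<d. \<Sum>i<n. c j i * (f i l * z l)) = (\<Sum>i<n. c j i * (\<Sum>l<d. f i l * z l))"
    by (subst sum.swap) (simp add: sum_distrib_left)
  also have "\<dots> = 0" using z by simp
  finally show False using jd by (simp add: P_iff)
qed

end

section \<open>Quadratic extensions\<close>

lemma subfieldD:
  assumes "subfield A"
  shows "0 \<in> A" "1 \<in> A" "x \<in> A \<Longrightarrow> y \<in> A \<Longrightarrow> x + y \<in> A"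
    "x \<in> A \<Longrightarrow> y \<in> A \<Longrightarrow> x * y \<in> A" "x \<in> A \<Longrightarrow> inverse x \<in> A"
    "x \<in> A \<Longrightarrow> y \<in> A \<Longrightarrow> x / y \<in> A" "x \<in> A \<Longrightarrow> x ^ n \<in> A"
proof -
  show *: "0 \<in> A" "1 \<in> A" "x \<in> A \<Longrightarrow> y \<in> A \<Longrightarrow> x + y \<in> A"
    "x \<in> A \<Longrightarrow> inverse x \<in> A" "x \<in> A \<Longrightarrow> y \<in> A \<Longrightarrow> x * y \<in> A" for x y
    using assms by (auto simp: subfield_def)
  show "x \<in> A \<Longrightarrow> y \<in> A \<Longrightarrow> x / y \<in> A"
    by (simp add: divide_inverse *)
  show "x \<in> A \<Longrightarrow> x ^ n \<in> A"
    by (induction n) (auto intro: *)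
qed

lemma subfield_sum: "subfield A \<Longrightarrow> (\<And>i. i \<in> I \<Longrightarrow> f i \<in> A) \<Longrightarrow> sum f I \<in> A"
  by (induction I rule: infinite_finite_induct) (auto intro: subfieldD)

context dval2
begin

lemma square_add: "(x + y) ^ 2 = x ^ 2 + (y::'a) ^ 2"
  by (simp add: power2_eq_square algebra_simps)

lemma complete_limit:
  fixes g :: "nat \<Rightarrow> 'a"
  assumes "complete_in v A" "\<And>n. g n \<in> A"
    "\<And>N. \<exists>M. \<forall>m\<ge>M. \<forall>n\<ge>M. g m + g n \<in> P N"
  obtains y where "y \<in> A" "\<And>N. \<exists>M. \<forall>n\<ge>M. g n + y \<in> P N"
  using assms(1)[unfolded complete_in_def diff_eq, rule_format, of g] assms(2,3) that by metis

text \<open>The root is \<open>r + r^2 + r^4 + r^8 + ...\<close>. Squaring is additive, so each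
  difference of consecutive partial sums is the square of the previous one, and the sums
  converge.\<close>

lemma artin_schreier_root:
  assumes A: "subfield A" "complete_in v A" and r: "r \<in> A" "r \<in> P 1"
  obtains z where "z \<in> A" "z + z ^ 2 = r"
proof -
  define f where "f = rec_nat r (\<lambda>_ z. r + z ^ 2)"
  have f0: "f 0 = r" and fS: "f (Suc n) = r + f n ^ 2" for n
    by (simp_all add: f_def)
  have fA: "f n \<in> A" for n
    by (induction n) (auto simp: f0 fS r intro!: subfieldD[OF A(1)])
  have step: "f (Suc n) + f n \<in> P (int n + 1)" for n
  proof (induction n)
    case 0
    show ?case using P_mult[OF r(2) r(2)] by (auto simp: fS f0 power2_eq_square add.commute elim: P_mono)
  next
    case (Suc n)
    have "f (Suc (Suc n)) + f (Suc n) = (f (Suc n) + f n) ^ 2"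
      by (subst (1 2) fS) (simp add: square_add add_ac)
    also have "\<dots> \<in> P (int (Suc n) + 1)"
      using P_mult[OF Suc Suc] by (auto simp: power2_eq_square elim: P_mono)
    finally show ?case .
  qed
  have tail: "f (M + k) + f M \<in> P (int M + 1)" for M k
  proof (induction k)
    case (Suc k)
    have "f (Suc (M + k)) + f (M + k) \<in> P (int M + 1)"
      using step[of "M + k"] by (rule P_mono) simp
    from P_add[OF this Suc] show ?case by (simp add: add.assoc)
  qed simp
  have cauchy: "f m + f n \<in> P (int M + 1)" if "M \<le> m" "M \<le> n" for m n M
  proof -
    have "(f m + f M) + (f n + f M) \<in> P (int M + 1)"
      using P_add[OF tail[of M "m - M"] tail[of M "n - M"]] that by simp
    then show ?thesis by (simp add: add_ac)
  qed
  have "\<exists>M. \<forall>m\<ge>M. \<forall>n\<ge>M. f m + f n \<in> P N" for N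
  proof (intro exI allI impI)
    fix m n assume "nat N \<le> m" "nat N \<le> n"
    then have "f m + f n \<in> P (int (nat N) + 1)" by (rule cauchy)
    then show "f m + f n \<in> P N" by (rule P_mono) simp
  qed
  with A(2) fA obtain z where z: "z \<in> A" "\<And>N. \<exists>M. \<forall>n\<ge>M. f n + z \<in> P N"
    by (rule complete_limit) blast
  have "z + (r + z ^ 2) \<in> P N" for N
  proof -
    \<comment> \<open>For a nonnegative exponent the square of a small error is at least as small;
      hence \<open>max N 0\<close>.\<close>
    obtain M where M: "f n + z \<in> P (max N 0)" if "n \<ge> M" for n using z(2) by blast
    have "(f M + z) * (f M + z) \<in> P (max N 0)"
      using P_mult[OF M M, of M M] by (rule P_mono) auto
    with M[of "Suc M"] have "(f (Suc M) + z) + (f M + z) ^ 2 \<in> P (max N 0)"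
      by (auto simp: power2_eq_square)
    also have "(f (Suc M) + z) + (f M + z) ^ 2 = z + (r + z ^ 2)"
      by (simp add: fS square_add add_ac)
    finally show ?thesis by (rule P_mono) simp
  qed
  then have "z + (r + z ^ 2) = 0" by (rule P_all_0)
  then have "r + (z + z ^ 2) = 0" by (simp only: add.left_commute)
  then have "z + z ^ 2 = r" by (simp only: add_eq_0)
  with z(1) that show ?thesis by blast
qed

end

text \<open>A Galois extension \<open>B\<close> of \<open>A\<close> of degree two inside the ambient
  field, with involution \<open>s\<close>. It is used for M over K and for L over M.\<close>

locale quadratic = dval2 v for v :: "'a::field \<Rightarrow> int" +
  fixes A B :: "'a set" and s :: "'a \<Rightarrow> 'a"
  assumes subA: "subfield A" and subB: "subfield B"
    and s_add: "s (x + y) = s x + s y" and s_mult: "s (x * y) = s x * s y"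
    and s_s: "s (s x) = x" and s_B: "x \<in> B \<Longrightarrow> s x \<in> B"
    and fixed: "A = {x \<in> B. s x = x}"
    and nontrivial: "\<exists>x\<in>B. s x \<noteq> x"
begin

lemma s_0 [simp]: "s 0 = 0"
  using s_add[of 0 0] by simp

lemma s_eq_0_iff [simp]: "s x = 0 \<longleftrightarrow> x = 0"
  using s_s[of x] by (metis s_0)

lemma s_1 [simp]: "s 1 = 1"
  using s_mult[of 1 1] s_eq_0_iff[of 1] by (metis mult_cancel_left1 mult_1_right one_neq_zero)

lemma s_divide: "s (x / y) = s x / s y"
proof (cases "y = 0")
  case False
  then show ?thesis using s_mult[of "x / y" y] by (simp add: nonzero_eq_divide_eq)
qed simp

lemma s_A: "x \<in> A \<Longrightarrow> s x = x"
  using fixed by auto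

lemma A_subset: "x \<in> A \<Longrightarrow> x \<in> B"
  using fixed by auto

text \<open>The trace \<open>x + s x\<close> is fixed by \<open>s\<close>; dividing by it normalizes
  the difference of \<open>s x\<close> and \<open>x\<close> to 1.\<close>

lemma exists_generator: "\<exists>x\<in>B. s x = x + 1"
proof -
  obtain x where x: "x \<in> B" "s x \<noteq> x" using nontrivial by blast
  let ?t = "x + s x"
  have t: "?t \<noteq> 0" "s ?t = ?t" using x by (auto simp: s_add s_s add.commute)
  have "s (x / ?t) = (x + ?t) / ?t" by (simp only: s_divide t) simp
  also have "\<dots> = x / ?t + 1" using t(1) by (metis add_divide_distrib divide_self)
  finally show ?thesis using x by (auto intro!: subfieldD[OF subB] s_B bexI[of _ "x / ?t"])
qed

text \<open>Since \<open>s\<close> changes \<open>a + b * x\<close> by \<open>b\<close>, the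
  coefficient of \<open>x\<close> has to be the trace \<open>y + s y\<close>.\<close>

lemma decompose:
  assumes "x \<in> B" "s x = x + 1" "y \<in> B"
  obtains a b where "a \<in> A" "b \<in> A" "y = a + b * x"
proof (rule that[of "y + (y + s y) * x" "y + s y"])
  show "y + s y \<in> A"
    using assms by (auto simp: fixed s_add s_s add.commute intro: subfieldD[OF subB] s_B)
  show "y + (y + s y) * x \<in> A"
    using assms by (auto simp: fixed s_add s_s s_mult algebra_simps intro!: subfieldD[OF subB] s_B)
  show "y = (y + (y + s y) * x) + (y + s y) * x"
    by (simp add: add.assoc)
qed

lemma not_v_less:
  assumes compl: "complete_in v A" and x: "x \<in> B" "x \<noteq> 0"
  shows "\<not> v (s x) < v x"
proof
  assume less: "v (s x) < v x"
  define y where "y = x / s x"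
  have y: "y \<in> B" "y \<noteq> 0" "s y = 1 / y" "v y > 0"
    using x less by (auto simp: y_def s_divide s_s v_divide intro: subfieldD[OF subB] s_B)
  \<comment> \<open>The trace of \<open>y\<close>, whose norm is 1:
    \<open>y^2 + t * y + 1 = 0\<close>. Because \<open>v t\<close> is negative,
    \<open>r = 1 / t\<close> lies in the maximal ideal.\<close>
  define t where "t = y + 1 / y"
  have vi: "v (1 / y) = - v y" using y v_divide[of 1 y] by simp
  have t: "v t = - v y" "t \<noteq> 0"
  proof -
    show "v t = - v y" using v_add_eq[of "1 / y" y] y vi by (simp add: t_def add.commute)
    have "y \<noteq> 1 / y" using y(4) vi by auto
    then show "t \<noteq> 0" by (simp add: t_def)
  qed
  have tA: "t \<in> A"
    using y by (auto simp: fixed t_def s_add s_divide add.commute intro!: subfieldD[OF subB])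
  define r where "r = 1 / t"
  have r: "r \<in> A" "r \<noteq> 0" "v r = v y"
    using tA t v_divide[of 1 t] by (auto simp: r_def intro: subfieldD[OF subA])
  have "y = r + r * y ^ 2"
  proof -
    have "t * y = y ^ 2 + 1" using y(2) by (simp add: t_def distrib_right power2_eq_square)
    then have "y = r * (y ^ 2 + 1)" using t(2) by (simp add: r_def field_simps)
    then show ?thesis by (simp add: algebra_simps)
  qed
  then have "r * y = r * (r + r * y ^ 2)" by (rule arg_cong)
  also have "\<dots> = r ^ 2 + (r * y) ^ 2" by (simp add: power2_eq_square algebra_simps)
  finally have "r * y + (r * y) ^ 2 = (r ^ 2 + (r * y) ^ 2) + (r * y) ^ 2" by (rule arg_cong)
  then have ry: "r * y + (r * y) ^ 2 = r ^ 2" by (simp only: add.assoc add_self add_0_right)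
  have "r ^ 2 \<in> A" "r ^ 2 \<in> P 1"
    using r y(4) by (auto simp: power2_eq_square P_iff v_mult intro: subfieldD[OF subA])
  with subA compl obtain z where z: "z \<in> A" "z + z ^ 2 = r ^ 2" by (rule artin_schreier_root)
  \<comment> \<open>Two roots of the same Artin-Schreier equation differ by 0 or 1, so
    \<open>r * y\<close> lies in \<open>A\<close> together with \<open>z\<close>.\<close>
  define u where "u = z + r * y"
  have "u * (u + 1) = (z + z ^ 2) + (r * y + (r * y) ^ 2)"
    by (simp add: u_def power2_eq_square algebra_simps)
  also have "\<dots> = 0" by (simp only: z(2) ry add_self)
  finally have "u * (u + 1) = 0" .
  then have "u \<in> A" using subfieldD[OF subA] by auto
  then have "(z + u) / r \<in> A" using z r by (intro subfieldD[OF subA])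
  also have "(z + u) / r = y" using r by (simp add: u_def)
  finally have "s y = y" by (rule s_A)
  with y vi show False by simp
qed

lemma isometry:
  assumes "complete_in v A" "x \<in> B" "x \<noteq> 0"
  shows "v (s x) = v x"
  using not_v_less[OF assms] not_v_less[OF assms(1), of "s x"] assms s_B by (auto simp: s_s)

lemma isometry_P:
  assumes "complete_in v A" "x \<in> B"
  shows "s x \<in> P n \<longleftrightarrow> x \<in> P n"
  using isometry[OF assms] by (cases "x = 0") (auto simp: Pideal_def)

text \<open>Limits are taken coordinatewise in \<open>a + b * x\<close>. The coordinate
  \<open>b\<close> is a trace, and isometry of \<open>s\<close> makes the traces of a Cauchy
  sequence Cauchy.\<close>

lemma complete_B:
  assumes compl: "complete_in v A"
  shows "complete_in v B"
  unfolding complete_in_def diff_eq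
proof (intro allI impI)
  fix g :: "nat \<Rightarrow> 'a"
  assume gB: "\<forall>n. g n \<in> B" and cauchy: "\<forall>N. \<exists>M. \<forall>m\<ge>M. \<forall>n\<ge>M. g m + g n \<in> P N"
  obtain x where x: "x \<in> B" "s x = x + 1" using exists_generator by blast
  have x0: "x \<noteq> 0" using x by auto
  define b where "b n = g n + s (g n)" for n
  define a where "a n = g n + b n * x" for n
  have bA: "b n \<in> A" for n
    using gB by (auto simp: fixed b_def s_add s_s add.commute intro: subfieldD[OF subB] s_B)
  have aA: "a n \<in> A" for n
    using gB x bA[of n] by (auto simp: fixed a_def s_add s_s s_mult x distrib_left intro!: subfieldD[OF subB] s_B)
      (simp add: b_def add_ac)
  have bc: "b m + b n \<in> P N" if "g m + g n \<in> P N" for m n N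
  proof -
    have "s (g m + g n) \<in> P N" using that gB
      by (subst isometry_P[OF compl]) (auto intro: subfieldD[OF subB])
    with that have "(g m + g n) + s (g m + g n) \<in> P N" by blast
    then show ?thesis by (simp add: b_def s_add add_ac)
  qed
  have mx: "c * x \<in> P N" if "c \<in> P (N - v x)" for c N
    using P_mult[OF that, of x "v x"] x0 by (simp add: P_iff)
  have "\<exists>M. \<forall>m\<ge>M. \<forall>n\<ge>M. b m + b n \<in> P N" for N
    using cauchy bc by meson
  with compl bA obtain b' where b': "b' \<in> A" "\<And>N. \<exists>M. \<forall>n\<ge>M. b n + b' \<in> P N"
    by (rule complete_limit) blast
  have "\<exists>M. \<forall>m\<ge>M. \<forall>n\<ge>M. a m + a n \<in> P N" for N
  proof -
    obtain M where M: "\<forall>m\<ge>M. \<forall>n\<ge>M. g m + g n \<in> P (max N (N - v x))" using cauchy by blast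
    have "a m + a n \<in> P N" if "m \<ge> M" "n \<ge> M" for m n
    proof -
      have g: "g m + g n \<in> P (max N (N - v x))" using M that by blast
      have "g m + g n \<in> P N" "(b m + b n) * x \<in> P N"
        using P_mono[OF g, of N] mx[OF P_mono[OF bc[OF g]], of N] by simp_all
      from P_add[OF this] show ?thesis by (simp add: a_def distrib_right add_ac)
    qed
    then show ?thesis by blast
  qed
  with compl aA obtain a' where a': "a' \<in> A" "\<And>N. \<exists>M. \<forall>n\<ge>M. a n + a' \<in> P N"
    by (rule complete_limit) blast
  have "\<exists>M. \<forall>n\<ge>M. g n + (a' + b' * x) \<in> P N" for N
  proof -
    obtain M1 where M1: "\<forall>n\<ge>M1. a n + a' \<in> P N" using a' by blast
    obtain M2 where M2: "\<forall>n\<ge>M2. b n + b' \<in> P (N - v x)" using b' by blast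
    have "g n + (a' + b' * x) \<in> P N" if "n \<ge> max M1 M2" for n
    proof -
      have "(a n + a') + (b n + b') * x \<in> P N"
        using M1 M2 that by (intro P_add[of "a n + a'", OF _ mx]) simp_all
      also have "(a n + a') + (b n + b') * x = g n + (a' + b' * x)"
        by (simp add: a_def distrib_right add_ac)
      finally show ?thesis .
    qed
    then show ?thesis by blast
  qed
  moreover have "a' + b' * x \<in> B"
    using a'(1) b'(1) by (intro subfieldD(3)[OF subB] subfieldD(4)[OF subB _ x(1)] A_subset)
  ultimately show "\<exists>y\<in>B. \<forall>N. \<exists>M. \<forall>n\<ge>M. g n + y \<in> P N" by blast
qed

section \<open>Generators of maximal valuation\<close>

lemma exists_best_generator:
  assumes compl: "complete_in v A"
  obtains x where "x \<in> B" "s x = x + 1" "\<forall>a\<in>A. v (x + a) \<le> v x"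
proof -
  \<comment> \<open>This bound makes a maximum exist: \<open>1 = x + s x\<close> is a sum of two
    elements of valuation \<open>v x\<close>.\<close>
  have neg: "v x \<le> 0" if "x \<in> B" "s x = x + 1" for x
  proof -
    have "x \<noteq> 0" using that by auto
    then have "v (s x) = v x" using isometry[OF compl that(1)] by blast
    then show ?thesis using v_add[of x "s x"] that \<open>x \<noteq> 0\<close> by (cases "x = 1") auto
  qed
  obtain x where x: "x \<in> B \<and> s x = x + 1"
      "\<And>y. y \<in> B \<and> s y = y + 1 \<Longrightarrow> nat (- v x) \<le> nat (- v y)"
    using exists_generator
      ex_has_least_nat[of "\<lambda>x. x \<in> B \<and> s x = x + 1" _ "\<lambda>x. nat (- v x)"] by blast
  have "v (x + a) \<le> v x" if "a \<in> A" for a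
  proof -
    have "x + a \<in> B \<and> s (x + a) = x + a + 1"
      using x that A_subset s_A by (auto simp: s_add add_ac intro: subfieldD[OF subB])
    with x(2)[of "x + a"] neg[of "x + a"] neg[of x] x(1) show ?thesis by linarith
  qed
  with x(1) that show ?thesis by blast
qed

context
  fixes x
  assumes x: "x \<in> B" "s x = x + 1" and best: "\<forall>a\<in>A. v (x + a) \<le> v x"
begin

text \<open>Maximality of \<open>v x\<close>, applied to the translate by \<open>a / b\<close>,
  bounds the valuation of \<open>a + b * x\<close> by that of \<open>b * x\<close>. The two summands
  therefore never cancel.\<close>

lemma P_decompose:
  assumes ab: "a \<in> A" "b \<in> A"
  shows "a + b * x \<in> P n \<longleftrightarrow> a \<in> P n \<and> b * x \<in> P n"
proof
  assume *: "a + b * x \<in> P n"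
  have "b * x \<in> P n"
  proof (cases "b = 0")
    case False
    have ne: "x \<noteq> 0" "x + a / b \<noteq> 0"
      using x s_A[of "a / b"] subfieldD(6)[OF subA ab] by auto
    have eq: "a + b * x = b * (x + a / b)" using False by (simp add: field_simps)
    have "a + b * x \<noteq> 0" unfolding eq using ne False by simp
    then have "n \<le> v (a + b * x)" using * P_iff by blast
    also have "\<dots> \<le> v (b * x)"
      using best[rule_format, of "a / b"] subfieldD(6)[OF subA ab] False ne unfolding eq by (simp add: v_mult del: add_eq_0)
    finally show ?thesis using False ne by (simp add: P_iff)
  qed simp
  with * show "a \<in> P n \<and> b * x \<in> P n" by (simp add: P_add_right)
qed auto

lemma value_cases:
  assumes "y \<in> B" "y \<noteq> 0"
  shows "\<exists>a\<in>A. a \<noteq> 0 \<and> (v y = v a \<or> v y = v a + v x)"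
proof -
  obtain a b where ab: "a \<in> A" "b \<in> A" "y = a + b * x" using decompose x assms by metis
  have x0: "x \<noteq> 0" using x by auto
  have "\<not> (a \<in> P (v y + 1) \<and> b * x \<in> P (v y + 1))"
    using P_decompose[OF ab(1,2), of "v y + 1"] assms ab(3) by (simp add: P_iff)
  moreover have "a \<in> P (v y) \<and> b * x \<in> P (v y)"
    using P_decompose[OF ab(1,2), of "v y"] assms ab(3) by (simp add: P_iff)
  ultimately show ?thesis
    using ab x0 by (cases "a = 0"; cases "b = 0") (auto simp: P_iff v_mult)
qed

end

end

section \<open>Totally ramified biquadratic extensions\<close>

locale biquadratic = dval2 v for v :: "'a::field \<Rightarrow> int" +
  fixes K :: "'a set" and G :: "('a \<Rightarrow> 'a) set"
  assumes subK: "subfield K"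
    and compl: "complete_in v K"
    and gal: "galois_with_group K G"
    and klein: "klein4 G"
    and totram: "totally_ramified4 v K"
begin

lemma G_iff: "g \<in> G \<longleftrightarrow> field_aut g \<and> (\<forall>x\<in>K. g x = x)"
  using gal unfolding galois_with_group_def by blast

lemma fixed_G: "(\<And>g. g \<in> G \<Longrightarrow> g x = x) \<Longrightarrow> x \<in> K"
  using gal unfolding galois_with_group_def by blast

lemma G_add: "g \<in> G \<Longrightarrow> g (x + y) = g x + g y"
  and G_mult: "g \<in> G \<Longrightarrow> g (x * y) = g x * g y"
  and G_K: "g \<in> G \<Longrightarrow> x \<in> K \<Longrightarrow> g x = x"
  by (auto simp: G_iff field_aut_def)

lemma G_1 [simp]: "g \<in> G \<Longrightarrow> g 1 = 1"
  and G_0 [simp]: "g \<in> G \<Longrightarrow> g 0 = 0"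
  by (auto simp: G_K subfieldD[OF subK])

lemma G_invol: "g \<in> G \<Longrightarrow> g (g x) = x"
  using klein unfolding klein4_def by (metis comp_apply id_apply)

lemma id_G: "id \<in> G"
  by (simp add: G_iff field_aut_def)

lemma comp_G: "g \<in> G \<Longrightarrow> h \<in> G \<Longrightarrow> g \<circ> h \<in> G"
  by (auto simp: G_iff field_aut_def intro: bij_comp)

lemma G_commute: "g \<in> G \<Longrightarrow> h \<in> G \<Longrightarrow> g (h x) = h (g x)"
  by (metis G_invol comp_G comp_apply)

lemma finite_G: "finite G"
  using gal unfolding galois_with_group_def by blast

lemma inverse_fixed:
  assumes "g \<in> G" "g x = x"
  shows "g (inverse x) = inverse x"
proof (cases "x = 0")
  case False
  then have "x * g (inverse x) = 1" using G_mult[of g x "inverse x"] assms by simp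
  then show ?thesis by (metis inverse_unique)
qed (use assms in simp)

lemma subfield_fixed: "g \<in> G \<Longrightarrow> subfield {x. g x = x}"
  by (auto simp: subfield_def G_add G_mult inverse_fixed)

lemma subfield_UNIV: "subfield (UNIV :: 'a set)"
  by (simp add: subfield_def)

lemma K_elem:
  assumes "4 dvd n"
  shows "\<exists>k\<in>K. k \<noteq> 0 \<and> v k = n"
proof -
  have "n \<in> v ` (K - {0})" using totram assms unfolding totally_ramified4_def by simp
  then show ?thesis by auto
qed

lemma K_dvd: "k \<in> K \<Longrightarrow> k \<noteq> 0 \<Longrightarrow> 4 dvd v k"
  using totram unfolding totally_ramified4_def by blast

section \<open>The tower of two quadratic layers cut out by an involution\<close>

context
  fixes \<sigma> \<tau>
  assumes st: "\<sigma> \<in> G" "\<tau> \<in> G" "\<sigma> \<noteq> id" "\<tau> \<noteq> id" "\<sigma> \<noteq> \<tau>"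
begin

lemma G_distinct: "distinct [id, \<sigma>, \<tau>, \<sigma> \<circ> \<tau>]"
proof -
  have "\<sigma> \<circ> \<tau> \<noteq> id"
  proof
    assume "\<sigma> \<circ> \<tau> = id"
    then have "\<sigma> (\<sigma> (\<tau> x)) = \<sigma> x" for x by (metis comp_apply id_apply)
    then have "\<tau> x = \<sigma> x" for x using st by (simp add: G_invol)
    with st show False by auto
  qed
  moreover have "\<sigma> \<circ> \<tau> \<noteq> \<sigma>"
  proof
    assume "\<sigma> \<circ> \<tau> = \<sigma>"
    then have "\<sigma> (\<sigma> (\<tau> x)) = \<sigma> (\<sigma> x)" for x by (metis comp_apply)
    then have "\<tau> x = x" for x using st by (simp add: G_invol)
    with st show False by auto
  qed
  moreover have "\<sigma> \<circ> \<tau> \<noteq> \<tau>"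
  proof
    assume "\<sigma> \<circ> \<tau> = \<tau>"
    then have "\<sigma> (\<tau> (\<tau> x)) = \<tau> (\<tau> x)" for x by (metis comp_apply)
    then have "\<sigma> x = x" for x using st by (simp add: G_invol)
    with st show False by auto
  qed
  ultimately show ?thesis using st by auto
qed

lemma G_eq: "G = {id, \<sigma>, \<tau>, \<sigma> \<circ> \<tau>}"
proof (rule sym, rule card_subset_eq)
  show "finite G" by (rule finite_G)
  show "{id, \<sigma>, \<tau>, \<sigma> \<circ> \<tau>} \<subseteq> G" using st id_G comp_G by auto
  show "card {id, \<sigma>, \<tau>, \<sigma> \<circ> \<tau>} = card G"
    using klein G_distinct distinct_card[OF G_distinct] by (simp add: klein4_def)
qed

lemma upper_step: "quadratic v {x. \<tau> x = x} UNIV \<tau>"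
  using st by unfold_locales (auto simp: subfield_fixed subfield_UNIV G_add G_mult G_invol fun_eq_iff)

lemma lower_step: "quadratic v K {x. \<tau> x = x} \<sigma>"
proof unfold_locales
  show "subfield K" by (rule subK)
  show "subfield {x. \<tau> x = x}" by (rule subfield_fixed) (rule st)
  show "\<sigma> (x + y) = \<sigma> x + \<sigma> y" "\<sigma> (x * y) = \<sigma> x * \<sigma> y" "\<sigma> (\<sigma> x) = x" for x y
    using st by (auto simp: G_add G_mult G_invol)
  show "\<sigma> x \<in> {x. \<tau> x = x}" if "x \<in> {x. \<tau> x = x}" for x
    using st G_commute[of \<tau> \<sigma> x] that by simp
  show "K = {x \<in> {x. \<tau> x = x}. \<sigma> x = x}"
    using st by (auto simp: G_K intro!: fixed_G) (auto simp: G_eq)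
  show "\<exists>x\<in>{x. \<tau> x = x}. \<sigma> x \<noteq> x"
  \<comment> \<open>If \<open>\<sigma>\<close> were trivial on the fixed field of
    \<open>\<tau>\<close>, it would fix \<open>x * x + x\<close>. Then \<open>\<sigma> x\<close> is
    \<open>x\<close> or \<open>x + 1\<close>, which forces \<open>\<sigma> = id\<close> or
    \<open>\<sigma> = \<tau>\<close>.\<close>
  proof (rule ccontr)
    assume "\<not> ?thesis"
    then have triv: "\<sigma> x = x" if "\<tau> x = x" for x using that by blast
    interpret quadratic v "{x. \<tau> x = x}" UNIV \<tau> by (rule upper_step)
    obtain x where x: "\<tau> x = x + 1" using exists_generator by blast
    define m where "m = \<sigma> x + x"
    have \<sigma>x: "\<sigma> x = x + m" by (simp add: m_def add.commute)
    have "\<tau> (\<sigma> x) = \<sigma> x + 1" using st x by (simp add: G_commute[of \<tau> \<sigma>] G_add)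
    then have "\<tau> m = m" using st x by (simp add: m_def G_add add_ac)
    have "\<tau> (x * x + x) = x * x + x" using st by (simp add: G_add G_mult x algebra_simps)
    then have "\<sigma> (x * x + x) = x * x + x" by (rule triv)
    then have "m * (m + 1) = 0"
      using st by (simp add: G_add G_mult \<sigma>x algebra_simps)
    then consider "m = 0" | "m = 1" by auto
    then show False
    proof cases
      case 1
      have "\<sigma> y = y" for y
      proof -
        obtain a b where "\<tau> a = a" "\<tau> b = b" "y = a + b * x"
          using decompose[of x y] x by auto
        with triv st \<sigma>x 1 show ?thesis by (simp add: G_add G_mult)
      qed
      then show False using st by auto
    next
      case 2
      have "\<sigma> y = \<tau> y" for y
      proof -
        obtain a b where "\<tau> a = a" "\<tau> b = b" "y = a + b * x"
          using decompose[of x y] x by auto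
        with triv st \<sigma>x 2 x show ?thesis by (simp add: G_add G_mult)
      qed
      then show False using st by auto
    qed
  qed
qed

lemma complete_fixed: "complete_in v {x. \<tau> x = x}"
  by (rule quadratic.complete_B[OF lower_step compl])

lemma \<tau>_isometry: "\<tau> x \<in> P n \<longleftrightarrow> x \<in> P n"
  using quadratic.isometry_P[OF upper_step complete_fixed] by simp

lemma exists_basis:
  obtains x1 x2 \<mu> where
    "\<sigma> x1 = x1 + 1" "\<tau> x1 = x1" "\<sigma> x2 = x2 + \<mu>" "\<tau> x2 = x2 + 1" "\<mu> \<in> K"
    "v x1 mod 4 = 2" "odd (v x2)"
    "\<And>y. \<exists>a\<in>K. \<exists>b\<in>K. \<exists>c\<in>K. \<exists>d\<in>K. y = a + b * x1 + c * x2 + d * x1 * x2"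
    "\<And>j. \<tau> \<in> ramgrp v G j \<longleftrightarrow> j \<le> - v x2"
proof -
  interpret u: quadratic v "{x. \<tau> x = x}" UNIV \<tau> by (rule upper_step)
  interpret l: quadratic v K "{x. \<tau> x = x}" \<sigma> by (rule lower_step)
  obtain x1 where x1: "x1 \<in> {x. \<tau> x = x}" "\<sigma> x1 = x1 + 1" "\<forall>a\<in>K. v (x1 + a) \<le> v x1"
    using l.exists_best_generator[OF compl] by metis
  obtain x2 where x2: "x2 \<in> UNIV" "\<tau> x2 = x2 + 1"
      "\<forall>a\<in>{x. \<tau> x = x}. v (x2 + a) \<le> v x2"
    using u.exists_best_generator[OF complete_fixed] by metis
  note val1 = l.value_cases[OF x1] and val2 = u.value_cases[OF x2]
  have ne: "x1 \<noteq> 0" "x2 \<noteq> 0" using x1 x2 st by auto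
  have M_val: "4 dvd v y \<or> 4 dvd (v y - v x1)" if y: "\<tau> y = y" "y \<noteq> 0" for y
  proof -
    obtain a where "a \<in> K" "a \<noteq> 0" "v y = v a \<or> v y = v a + v x1"
      using val1[of y] y by auto
    with K_dvd[of a] show ?thesis by auto
  qed
  \<comment> \<open>Either alternative makes \<open>v x1\<close> even, and with it every valuation
    on the fixed field of \<open>\<tau>\<close>. An element of valuation 1 then requires
    \<open>v x2\<close> to be odd.\<close>
  have "4 dvd 2 * v x1 \<or> 4 dvd v x1"
    using M_val[of "x1 * x1"] x1 ne st by (simp add: G_mult v_mult)
  then have "even (v x1)" by presburger
  then have M_even: "even (v y)" if "\<tau> y = y" "y \<noteq> 0" for y
    using M_val[OF that] by presburger
  obtain p where p: "p \<noteq> 0" "v p = 1" using val by (auto simp: normalized_dval_def)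
  have odd: "odd (v x2)"
  proof -
    obtain a where "\<tau> a = a" "a \<noteq> 0" "v p = v a \<or> v p = v a + v x2"
      using val2[of p] p by auto
    moreover from this have "even (v a)" by (simp add: M_even)
    ultimately show ?thesis using p(2) by presburger
  qed
  \<comment> \<open>\<open>v (x2 * x2)\<close> is even while \<open>v a + v x2\<close> is odd, so it
    is attained on the fixed field. Being twice an odd number, it is 2 modulo 4, and only
    \<open>v x1\<close> can account for that residue.\<close>
  have "\<exists>y. \<tau> y = y \<and> y \<noteq> 0 \<and> v y = 2 * v x2"
  proof -
    obtain a where "\<tau> a = a" "a \<noteq> 0" "v (x2 * x2) = v a \<or> v (x2 * x2) = v a + v x2"
      using val2[of "x2 * x2"] ne by auto
    with M_even[of a] odd ne show ?thesis by (auto simp: v_mult)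
  qed
  then obtain y where "\<tau> y = y" "y \<noteq> 0" "v y = 2 * v x2" by blast
  then have v1: "v x1 mod 4 = 2" using M_val[of y] odd by presburger
  \<comment> \<open>Fixed by \<open>\<tau>\<close> because the two automorphisms commute, and by
    \<open>\<sigma>\<close> because it is an involution; hence an element of
    \<open>K\<close>.\<close>
  define \<mu> where "\<mu> = \<sigma> x2 + x2"
  have "\<tau> (\<sigma> x2) = \<sigma> x2 + 1" using st x2 by (simp add: G_commute[of \<tau> \<sigma>] G_add)
  then have "\<mu> \<in> K" using st x2 unfolding l.fixed by (simp add: \<mu>_def G_add G_invol add_ac)
  have \<sigma>x2: "\<sigma> x2 = x2 + \<mu>" by (simp add: \<mu>_def add.commute)
  have basis: "\<exists>a\<in>K. \<exists>b\<in>K. \<exists>c\<in>K. \<exists>d\<in>K. y = a + b * x1 + c * x2 + d * x1 * x2" for y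
  proof -
    obtain a b where ab: "\<tau> a = a" "\<tau> b = b" "y = a + b * x2"
      using u.decompose[OF x2(1,2), of y] by auto
    obtain a1 a2 where a: "a1 \<in> K" "a2 \<in> K" "a = a1 + a2 * x1"
      using l.decompose[OF x1(1,2), of a] ab by auto
    obtain b1 b2 where b: "b1 \<in> K" "b2 \<in> K" "b = b1 + b2 * x1"
      using l.decompose[OF x1(1,2), of b] ab by auto
    have "y = a1 + a2 * x1 + b1 * x2 + b2 * x1 * x2"
      using ab a b by (simp add: algebra_simps)
    then show ?thesis using a b by blast
  qed
  \<comment> \<open>\<open>\<tau>\<close> moves \<open>a + b * x2\<close> by \<open>b\<close>.
    Integrality of \<open>b * x2\<close> gives \<open>v b \<ge> - v x2\<close>, parity improves this
    to \<open>1 - v x2\<close>, and some \<open>b\<close> attains it. This 1 matches the shift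
    \<open>j + 1\<close> in \<open>ramgrp\<close>.\<close>
  have ram: "\<tau> \<in> ramgrp v G j \<longleftrightarrow> j \<le> - v x2" for j
  proof
    assume "\<tau> \<in> ramgrp v G j"
    then have *: "\<tau> x + x \<in> P (j + 1)" if "x \<in> P 0" for x
      using that by (simp add: ramgrp_def)
    have "\<exists>b. \<tau> b = b \<and> b \<noteq> 0 \<and> v b = 1 - v x2"
    proof (cases "4 dvd 1 - v x2")
      case True
      then show ?thesis using K_elem G_K st by metis
    next
      case False
      then have "4 dvd 1 - v x2 - v x1" using odd v1 by presburger
      then obtain k where "k \<in> K" "k \<noteq> 0" "v k = 1 - v x2 - v x1" using K_elem by blast
      then show ?thesis using x1 ne st by (intro exI[of _ "k * x1"]) (simp add: G_mult G_K v_mult)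
    qed
    then obtain b where b: "\<tau> b = b" "b \<noteq> 0" "v b = 1 - v x2" by blast
    have "b * x2 \<in> P 0" using b ne by (simp add: P_iff v_mult)
    from *[OF this] b x2 st have "b \<in> P (j + 1)" by (simp add: G_mult distrib_left add_ac)
    with b show "j \<le> - v x2" by (simp add: P_iff)
  next
    assume j: "j \<le> - v x2"
    have "\<tau> x + x \<in> P (j + 1)" if x: "x \<in> P 0" for x
    proof -
      obtain a b where ab: "\<tau> a = a" "\<tau> b = b" "x = a + b * x2"
        using u.decompose[OF x2(1,2), of x] by auto
      have eq: "\<tau> x + x = b" using ab st x2 by (simp add: G_add G_mult distrib_left add_ac)
      have "b * x2 \<in> P 0" using u.P_decompose[OF x2, of a b 0] ab x by simp
      show ?thesis unfolding eq
      proof (cases "b = 0")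
        case False
        then have "0 \<le> v b + v x2" using \<open>b * x2 \<in> P 0\<close> ne by (simp add: P_iff v_mult)
        moreover have "v b \<noteq> - v x2" using M_even[OF ab(2) False] odd by auto
        ultimately show "b \<in> P (j + 1)" using j False by (simp add: P_iff)
      qed simp
    qed
    then show "\<tau> \<in> ramgrp v G j" using st by (simp add: ramgrp_def)
  qed
  show ?thesis
    using that[OF x1(2) _ \<sigma>x2 x2(2) \<open>\<mu> \<in> K\<close> v1 odd basis ram] x1(1) by simp
qed

end

lemma exists_other:
  assumes "\<tau> \<in> G"
  obtains \<sigma> where "\<sigma> \<in> G" "\<sigma> \<noteq> id" "\<sigma> \<noteq> \<tau>"
proof -
  have "\<not> G \<subseteq> {id, \<tau>}"
  proof
    assume "G \<subseteq> {id, \<tau>}"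
    then have "card G \<le> card {id, \<tau>}" by (intro card_mono) auto
    also have "\<dots> \<le> 2" by (rule card_insert_le_m1) auto
    finally show False using klein by (simp add: klein4_def)
  qed
  with that show ?thesis by blast
qed

section \<open>Ramification groups and the first break\<close>

lemma ramgrp_comp:
  assumes g: "g \<in> ramgrp v G j" and h: "h \<in> ramgrp v G j"
  shows "g \<circ> h \<in> ramgrp v G j"
proof -
  have G: "g \<in> G" "h \<in> G" using g h by (auto simp: ramgrp_def)
  have "g (h x) + x \<in> P (j + 1)" if x: "x \<in> P 0" for x
  proof -
    have "h x \<in> P 0"
    proof (cases "h = id")
      case False
      with G x show ?thesis using exists_other[of h] \<tau>_isometry by metis
    qed (use x in simp)
    then have "g (h x) + h x \<in> P (j + 1)" "h x + x \<in> P (j + 1)"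
      using g h x by (auto simp: ramgrp_def)
    from P_add[OF this] show ?thesis by (simp add: add.assoc)
  qed
  then show ?thesis using comp_G[OF G] by (simp add: ramgrp_def)
qed

text \<open>Choosing \<open>\<tau>\<close> with minimal break makes \<open>b\<^sub>1\<close> the break of the top layer of the tower,
  and \<open>b\<^sub>2\<close> is then irrelevant.\<close>

lemma exists_first_break:
  obtains \<tau> where "\<tau> \<in> G" "\<tau> \<noteq> id" "\<And>j. \<tau> \<in> ramgrp v G j \<longleftrightarrow> j \<le> lower_break v G 1"
proof -
  \<comment> \<open>Each nontrivial element of \<open>G\<close> can play the part of
    \<open>\<tau>\<close> in \<open>exists_basis\<close>, with its own \<open>x2\<close>.\<close>
  have "\<exists>\<beta>. \<forall>j. g \<in> ramgrp v G j \<longleftrightarrow> j \<le> \<beta>" if "g \<in> G - {id}" for g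
    using that exists_other[of g] exists_basis[of _ g] by (metis Diff_iff singletonI)
  then obtain \<beta> where \<beta>: "\<And>g j. g \<in> G - {id} \<Longrightarrow> g \<in> ramgrp v G j \<longleftrightarrow> j \<le> \<beta> g"
    by metis
  have "G - {id} \<noteq> {}" using exists_other[OF id_G] by blast
  then obtain \<tau> where \<tau>: "\<tau> \<in> G - {id}" "\<And>g. g \<in> G - {id} \<Longrightarrow> \<beta> \<tau> \<le> \<beta> g"
    using arg_min_if_finite(1)[of "G - {id}" \<beta>] arg_min_least[of "G - {id}" _ \<beta>] finite_G by blast
  then obtain \<sigma> where \<sigma>: "\<sigma> \<in> G" "\<sigma> \<noteq> id" "\<sigma> \<noteq> \<tau>" using exists_other by blast
  have Geq: "G = {id, \<sigma>, \<tau>, \<sigma> \<circ> \<tau>}" using G_eq \<sigma> \<tau> by blast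
  have large: "2 < card (ramgrp v G j) \<longleftrightarrow> j \<le> \<beta> \<tau>" for j
  proof (cases "j \<le> \<beta> \<tau>")
    case True
    then have "g \<in> ramgrp v G j" if "g \<in> G" for g
      using \<beta>[of g j] \<tau>(2)[of g] that by (cases "g = id") (auto simp: ramgrp_def id_G)
    then have "ramgrp v G j = G" by (auto simp: ramgrp_def)
    then show ?thesis using klein True by (simp add: klein4_def)
  next
    case False
    then have "\<tau> \<notin> ramgrp v G j" using \<beta> \<tau> by blast
    \<comment> \<open>\<open>\<tau>\<close> is the product of the other two involutions, so when it
      is missing from the ramification group one of them is missing as well.\<close>
    moreover have "\<sigma> \<circ> (\<sigma> \<circ> \<tau>) = \<tau>" using G_invol[OF \<sigma>(1)] by (simp add: fun_eq_iff)
    ultimately have "\<sigma> \<notin> ramgrp v G j \<or> \<sigma> \<circ> \<tau> \<notin> ramgrp v G j" using ramgrp_comp by metis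
    with \<open>\<tau> \<notin> ramgrp v G j\<close>
    have "ramgrp v G j \<subseteq> {id, \<sigma>} \<or> ramgrp v G j \<subseteq> {id, \<sigma> \<circ> \<tau>}"
      using Geq by (auto simp: ramgrp_def)
    moreover have "card S \<le> 2" if "S \<subseteq> {a, b}" for S and a b :: "'a \<Rightarrow> 'a"
      using card_mono[OF _ that] card_insert_le_m1[of 2 "{b}" a] by simp
    ultimately have "card (ramgrp v G j) \<le> 2" by blast
    with False show ?thesis by simp
  qed
  then have "lower_break v G 1 = \<beta> \<tau>"
    unfolding lower_break_def by (intro Greatest_equality) auto
  with \<beta> \<tau> that show ?thesis by auto
qed

end


section \<open>Module structure in an adapted basis\<close>

text \<open>In the basis \<open>1, x1, x2, x1 * x2\<close> the elements
  \<open>\<Psi>1 = 1 + \<sigma> + \<mu> (\<sigma> + \<sigma> \<tau>)\<close> and \<open>\<Psi>2 = 1 + \<tau>\<close> of \<open>K[G]\<close> act as \<open>\<partial>/\<partial>x1\<close> and \<open>\<partial>/\<partial>x2\<close>;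
  \<open>gel k0 k1 k2 k3\<close> stands for \<open>k0 + k1 \<Psi>1 + k2 \<Psi>2 + k3 \<Psi>1 \<Psi>2\<close>.\<close>

locale adapted_basis = biquadratic v K G
  for v :: "'a::field \<Rightarrow> int" and K :: "'a set" and G :: "('a \<Rightarrow> 'a) set" +
  fixes \<sigma> \<tau> :: "'a \<Rightarrow> 'a" and x1 x2 \<mu> :: 'a and h :: int
  assumes st: "\<sigma> \<in> G" "\<tau> \<in> G" "\<sigma> \<noteq> id" "\<tau> \<noteq> id" "\<sigma> \<noteq> \<tau>"
    and basis: "\<sigma> x1 = x1 + 1" "\<tau> x1 = x1" "\<sigma> x2 = x2 + \<mu>" "\<tau> x2 = x2 + 1" "\<mu> \<in> K"
    and v_x1: "v x1 mod 4 = 2" and v_x2: "odd (v x2)"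
    and span: "\<exists>a\<in>K. \<exists>b\<in>K. \<exists>c\<in>K. \<exists>d\<in>K. y = a + b * x1 + c * x2 + d * x1 * x2"
begin

definition el where
  "el a b c d = a + b * x1 + c * x2 + d * x1 * x2"

text \<open>In \<open>\<Psi>1\<close> the term \<open>\<mu> (\<sigma> + \<sigma> \<tau>)\<close>
  cancels the value \<open>\<mu>\<close> of \<open>1 + \<sigma>\<close> at \<open>x2\<close>. The
  product \<open>\<Psi>1 \<Psi>2\<close> is the sum of all elements of \<open>G\<close>, which is
  why \<open>k3\<close> enters every coefficient.\<close>

definition gel where
  "gel k0 k1 k2 k3 = (\<lambda>g. if g = id then k0 + k1 + k2 + k3 else if g = \<sigma> then k1 + \<mu> * k1 + k3
     else if g = \<tau> then k2 + k3 else if g = \<sigma> \<circ> \<tau> then \<mu> * k1 + k3 else 0)"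

text \<open>A power of the maximal ideal of \<open>K\<close>, indexed by the normalized valuation of
  \<open>K\<close>, which is \<open>v\<close> divided by 4.\<close>

definition Q where "Q m = K \<inter> P (4 * m)"

text \<open>A generator of \<open>Q m\<close>. Only its valuation matters, so these are chosen
  independently and not as powers of one uniformizer.\<close>

definition p where "p m = (SOME k. k \<in> K \<and> k \<noteq> 0 \<and> v k = 4 * m)"

lemmas K_simps [simp] = subfieldD[OF subK]

lemma p_props: "p m \<in> K \<and> p m \<noteq> 0 \<and> v (p m) = 4 * m"
  unfolding p_def by (rule someI_ex) (use K_elem[of "4 * m"] in auto)

lemma p_K [simp]: "p m \<in> K" and p_ne [simp]: "p m \<noteq> 0" and v_p [simp]: "v (p m) = 4 * m"
  using p_props by auto

lemma Q_K: "a \<in> Q m \<Longrightarrow> a \<in> K"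
  by (simp add: Q_def)

lemma Q_0 [simp]: "0 \<in> Q m"
  by (simp add: Q_def)

lemma Q_add: "a \<in> Q m \<Longrightarrow> b \<in> Q m \<Longrightarrow> a + b \<in> Q m"
  by (auto simp: Q_def)

lemma Q_sum: "(\<And>i. i \<in> I \<Longrightarrow> f i \<in> Q m) \<Longrightarrow> sum f I \<in> Q m"
  by (induction I rule: infinite_finite_induct) (auto intro: Q_add)

lemma Q_mult: "a \<in> Q m \<Longrightarrow> b \<in> Q n \<Longrightarrow> l \<le> m + n \<Longrightarrow> a * b \<in> Q l"
  unfolding Q_def by (auto intro: P_mono[OF P_mult])

lemma Q_mono: "a \<in> Q m \<Longrightarrow> l \<le> m \<Longrightarrow> a \<in> Q l"
  by (auto simp: Q_def elim: P_mono)

lemma p_Q: "l \<le> m \<Longrightarrow> p m \<in> Q l"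
  by (simp add: Q_def P_iff)

lemma Q_divide: "a \<in> Q m \<Longrightarrow> l \<le> m - n \<Longrightarrow> a / p n \<in> Q l"
  by (cases "a = 0") (auto simp: Q_def P_iff v_divide)

lemma Q_mult_p: "a \<in> K \<Longrightarrow> a * p n \<in> Q m \<longleftrightarrow> a \<in> Q (m - n)"
  by (cases "a = 0") (auto simp: Q_def P_iff v_mult)

lemma x_ne [simp]: "x1 \<noteq> 0" "x2 \<noteq> 0"
  using basis st by auto

section \<open>Valuations in the adapted basis\<close>

lemma v_add_distinct:
  assumes "u \<noteq> 0" "w \<noteq> 0" "v u \<noteq> v w"
  shows "v (u + w) = min (v u) (v w)"
  using assms v_add_eq[of u w] v_add_eq[of w u]
  by (auto simp: add.commute min_def order.order_iff_strict)

lemma P_add_distinct: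
  assumes "u \<noteq> 0 \<Longrightarrow> w \<noteq> 0 \<Longrightarrow> v u \<noteq> v w"
  shows "u + w \<in> P n \<longleftrightarrow> u \<in> P n \<and> w \<in> P n"
proof (cases "u = 0 \<or> w = 0")
  case False
  then have "v (u + w) = min (v u) (v w)" "u + w \<noteq> 0"
    using assms v_add_distinct[of u w] by auto
  with False show ?thesis by (simp add: P_iff del: add_eq_0)
qed auto

lemma even_v_M:
  assumes "a \<in> K" "b \<in> K" "a + b * x1 \<noteq> 0"
  shows "even (v (a + b * x1))"
proof -
  have ev: "even (v a)" if "a \<in> K" "a \<noteq> 0" for a using K_dvd[OF that] by presburger
  have ev1: "even (v x1)" using v_x1 by presburger
  consider "a = 0" | "b = 0" | "a \<noteq> 0" "b \<noteq> 0" by blast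
  then show ?thesis
  proof cases
    case 3
    then have "v a \<noteq> v (b * x1)"
      using K_dvd[OF assms(1) 3(1)] K_dvd[OF assms(2) 3(2)] v_x1 by (simp add: v_mult) presburger
    then have "v (a + b * x1) = min (v a) (v (b * x1))" using 3 by (intro v_add_distinct) auto
    then show ?thesis using ev assms 3 ev1 by (simp add: v_mult min_def)
  qed (use assms ev ev1 in \<open>auto simp: v_mult\<close>)
qed

text \<open>Parity of the valuation separates \<open>a + b * x1\<close> from its counterpart times
  \<open>x2\<close>; within each pair, \<open>v x1 mod 4 = 2\<close> separates the two
  terms.\<close>

lemma el_P_terms:
  assumes "a \<in> K" "b \<in> K" "c \<in> K" "d \<in> K"
  shows "el a b c d \<in> P n \<longleftrightarrow> a \<in> P n \<and> b * x1 \<in> P n \<and> c * x2 \<in> P n \<and> d * (x1 * x2) \<in> P n"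
proof -
  have *: "a + b * x1 \<in> P n \<longleftrightarrow> a \<in> P n \<and> b * x1 \<in> P n"
    using assms K_dvd[of a] K_dvd[of b] v_x1
    by (intro P_add_distinct) (auto simp: v_mult, presburger)
  have **: "c * x2 + d * (x1 * x2) \<in> P n \<longleftrightarrow> c * x2 \<in> P n \<and> d * (x1 * x2) \<in> P n"
    using assms K_dvd[of c] K_dvd[of d] v_x1
    by (intro P_add_distinct) (auto simp: v_mult, presburger)
  have eq: "c * x2 + d * (x1 * x2) = (c + d * x1) * x2" by (simp add: algebra_simps)
  have "el a b c d = (a + b * x1) + (c * x2 + d * (x1 * x2))"
    by (simp add: el_def algebra_simps)
  also have "\<dots> \<in> P n \<longleftrightarrow> a + b * x1 \<in> P n \<and> c * x2 + d * (x1 * x2) \<in> P n"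
    using even_v_M[of a b] even_v_M[of c d] assms v_x2 unfolding eq
    by (intro P_add_distinct) (auto simp: v_mult simp del: add_eq_0)
  finally show ?thesis using * ** by blast
qed

text \<open>The exponents \<open>\<lceil>(h - v e) / 4\<rceil>\<close> for \<open>e = 1, x1, x2, x1 * x2\<close>.\<close>

definition "mA = - ((- h) div 4)"
definition "mB = - ((v x1 - h) div 4)"
definition "mC = - ((v x2 - h) div 4)"
definition "mD = - ((v x1 + v x2 - h) div 4)"

lemma term_P:
  assumes "k \<in> K" "e \<noteq> 0"
  shows "k * e \<in> P h \<longleftrightarrow> k \<in> Q (- ((v e - h) div 4))"
proof (cases "k = 0")
  case False
  obtain q where q: "v k = 4 * q" using K_dvd[OF assms(1) False] by (auto simp: dvd_def)
  have "h \<le> 4 * q + v e \<longleftrightarrow> - ((v e - h) div 4) \<le> q" by presburger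
  with q False assms show ?thesis by (simp add: Q_def P_iff v_mult)
qed simp

lemma el_P:
  assumes "a \<in> K" "b \<in> K" "c \<in> K" "d \<in> K"
  shows "el a b c d \<in> P h \<longleftrightarrow> a \<in> Q mA \<and> b \<in> Q mB \<and> c \<in> Q mC \<and> d \<in> Q mD"
  using el_P_terms[OF assms, of h] term_P[of a 1] term_P[of b x1] term_P[of c x2]
    term_P[of d "x1 * x2"] assms
  by (simp add: v_mult mA_def mB_def mC_def mD_def)

lemma el_surj: "\<exists>a b c d. a \<in> K \<and> b \<in> K \<and> c \<in> K \<and> d \<in> K \<and> y = el a b c d"
  using span[of y] unfolding el_def by blast

lemma el_P_cases:
  assumes "y \<in> P h"
  obtains a b c d where "a \<in> Q mA" "b \<in> Q mB" "c \<in> Q mC" "d \<in> Q mD" "y = el a b c d"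
  using el_surj[of y] el_P assms by metis

lemma el_add: "el a b c d + el a' b' c' d' = el (a + a') (b + b') (c + c') (d + d')"
  by (simp add: el_def algebra_simps)

text \<open>Linear independence comes from the valuations: 0 lies in every \<open>P n\<close>, hence
  so does each term.\<close>

lemma el_eq_0:
  assumes "a \<in> K" "b \<in> K" "c \<in> K" "d \<in> K" "el a b c d = 0"
  shows "a = 0 \<and> b = 0 \<and> c = 0 \<and> d = 0"
proof -
  have "a \<in> P n \<and> b * x1 \<in> P n \<and> c * x2 \<in> P n \<and> d * (x1 * x2) \<in> P n" for n
    using el_P_terms[OF assms(1-4), of n] assms(5) by simp
  then show ?thesis using P_all_0 by (metis mult_eq_0_iff x_ne)
qed

lemma el_eq_iff:
  assumes "a \<in> K" "b \<in> K" "c \<in> K" "d \<in> K" "a' \<in> K" "b' \<in> K" "c' \<in> K" "d' \<in> K"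
  shows "el a b c d = el a' b' c' d' \<longleftrightarrow> a = a' \<and> b = b' \<and> c = c' \<and> d = d'"
proof -
  have "el a b c d = el a' b' c' d' \<longleftrightarrow> el (a + a') (b + b') (c + c') (d + d') = 0"
    by (simp flip: el_add)
  also have "\<dots> \<longleftrightarrow> a + a' = 0 \<and> b + b' = 0 \<and> c + c' = 0 \<and> d + d' = 0"
  proof
    assume "el (a + a') (b + b') (c + c') (d + d') = 0"
    then show "a + a' = 0 \<and> b + b' = 0 \<and> c + c' = 0 \<and> d + d' = 0"
      using assms by (intro el_eq_0) simp_all
  qed (simp only: el_def, simp)
  finally show ?thesis by simp
qed

section \<open>The group algebra as polynomials in \<open>\<Psi>1\<close> and \<open>\<Psi>2\<close>
  modulo their squares\<close>

lemma G_dist [simp]: "\<sigma> \<noteq> id" "\<tau> \<noteq> id" "\<sigma> \<noteq> \<tau>" "\<tau> \<noteq> \<sigma>" "\<sigma> \<circ> \<tau> \<noteq> id"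
    "\<sigma> \<circ> \<tau> \<noteq> \<sigma>" "\<sigma> \<circ> \<tau> \<noteq> \<tau>" "id \<noteq> \<sigma>" "id \<noteq> \<tau>" "id \<noteq> \<sigma> \<circ> \<tau>" "\<sigma> \<noteq> \<sigma> \<circ> \<tau>" "\<tau> \<noteq> \<sigma> \<circ> \<tau>"
  using G_distinct[OF st] by auto

lemma G_set: "G = {id, \<sigma>, \<tau>, \<sigma> \<circ> \<tau>}"
  by (rule G_eq[OF st])

lemma sum_G: "sum f G = f id + f \<sigma> + f \<tau> + f (\<sigma> \<circ> \<tau>)"
  unfolding G_set by (simp add: add.assoc)

lemma G_table: "\<sigma> \<circ> \<sigma> = id" "\<tau> \<circ> \<tau> = id" "\<tau> \<circ> \<sigma> = \<sigma> \<circ> \<tau>" "\<sigma> \<circ> (\<sigma> \<circ> \<tau>) = \<tau>"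
    "\<tau> \<circ> (\<sigma> \<circ> \<tau>) = \<sigma>" "\<sigma> \<circ> \<tau> \<circ> \<sigma> = \<tau>" "\<sigma> \<circ> \<tau> \<circ> \<tau> = \<sigma>" "\<sigma> \<circ> \<tau> \<circ> (\<sigma> \<circ> \<tau>) = id"
  using G_invol[OF st(1)] G_invol[OF st(2)] G_commute[OF st(1,2)] by (simp_all add: fun_eq_iff)

lemma gel_simps [simp]:
  "gel k0 k1 k2 k3 id = k0 + k1 + k2 + k3" "gel k0 k1 k2 k3 \<sigma> = k1 + \<mu> * k1 + k3"
  "gel k0 k1 k2 k3 \<tau> = k2 + k3" "gel k0 k1 k2 k3 (\<sigma> \<circ> \<tau>) = \<mu> * k1 + k3"
  by (simp_all add: gel_def)

lemma gel_outside: "g \<notin> G \<Longrightarrow> gel k0 k1 k2 k3 g = 0"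
  by (simp add: gel_def G_set)

lemma eq_gelI:
  assumes "f id = k0 + k1 + k2 + k3" "f \<sigma> = k1 + \<mu> * k1 + k3" "f \<tau> = k2 + k3"
    "f (\<sigma> \<circ> \<tau>) = \<mu> * k1 + k3" "\<And>g. g \<notin> G \<Longrightarrow> f g = 0"
  shows "f = gel k0 k1 k2 k3"
proof
  fix g show "f g = gel k0 k1 k2 k3 g"
    using assms gel_outside[of g] by (cases "g \<in> G") (auto simp: G_set)
qed

lemma gel_eq_iff: "gel a b c d = gel a' b' c' d' \<longleftrightarrow> a = a' \<and> b = b' \<and> c = c' \<and> d = d'"
proof
  assume eq: "gel a b c d = gel a' b' c' d'"
  have "b + (\<mu> * b + d) = b' + (\<mu> * b' + d')" and d: "\<mu> * b + d = \<mu> * b' + d'"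
    and c: "c + d = c' + d'" and a: "a + b + c + d = a' + b' + c' + d'"
    using fun_cong[OF eq, of \<sigma>] fun_cong[OF eq, of "\<sigma> \<circ> \<tau>"] fun_cong[OF eq, of \<tau>] fun_cong[OF eq, of id]
    by (simp_all add: add.assoc)
  then have "b = b'" by simp
  with d c a show "a = a' \<and> b = b' \<and> c = c' \<and> d = d'" by simp
qed simp

lemma grpalg_iff: "\<alpha> \<in> grpalg K G \<longleftrightarrow> (\<exists>k0 k1 k2 k3. k0 \<in> K \<and> k1 \<in> K \<and> k2 \<in> K \<and> k3 \<in> K \<and> \<alpha> = gel k0 k1 k2 k3)"
proof
  assume \<alpha>: "\<alpha> \<in> grpalg K G"
  define k1 where "k1 = \<alpha> \<sigma> + \<alpha> (\<sigma> \<circ> \<tau>)"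
  define k3 where "k3 = \<alpha> (\<sigma> \<circ> \<tau>) + \<mu> * k1"
  define k2 where "k2 = \<alpha> \<tau> + k3"
  define k0 where "k0 = \<alpha> id + k1 + k2 + k3"
  have \<alpha>K: "\<alpha> g \<in> K" if "g \<in> G" for g using \<alpha> that by (simp add: grpalg_def)
  have K: "k1 \<in> K" "k3 \<in> K" "k2 \<in> K" "k0 \<in> K"
    using \<alpha>K[of id] \<alpha>K[of \<sigma>] \<alpha>K[of \<tau>] \<alpha>K[of "\<sigma> \<circ> \<tau>"] st id_G comp_G basis(5)
    by (simp_all add: k1_def k3_def k2_def k0_def)
  moreover have "\<alpha> = gel k0 k1 k2 k3"
    using \<alpha> by (intro eq_gelI)
      (simp_all add: k0_def k1_def k2_def k3_def grpalg_def add_ac distrib_left)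
  ultimately show "\<exists>k0 k1 k2 k3. k0 \<in> K \<and> k1 \<in> K \<and> k2 \<in> K \<and> k3 \<in> K \<and> \<alpha> = gel k0 k1 k2 k3" by blast
next
  assume "\<exists>k0 k1 k2 k3. k0 \<in> K \<and> k1 \<in> K \<and> k2 \<in> K \<and> k3 \<in> K \<and> \<alpha> = gel k0 k1 k2 k3"
  then show "\<alpha> \<in> grpalg K G"
    using gel_outside basis(5) by (auto simp: grpalg_def G_set)
qed

lemma gel_act:
  assumes "a \<in> K" "b \<in> K" "c \<in> K" "d \<in> K"
  shows "ga_act G (gel k0 k1 k2 k3) (el a b c d) =
    el (k0 * a + k1 * b + k2 * c + k3 * d) (k0 * b + k2 * d) (k0 * c + k1 * d) (k0 * d)"
  using st assms
  by (simp add: ga_act_def sum_G el_def G_add G_mult G_K basis algebra_simps)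

text \<open>No \<open>k1 * l1\<close> or \<open>k2 * l2\<close> occurs:
  \<open>(1 + g)^2 = 1 + g^2 = 0\<close> for all \<open>g\<close> in \<open>G\<close>, so
  \<open>\<Psi>1\<close> and \<open>\<Psi>2\<close> both square to zero.\<close>

lemma gel_mult:
  "ga_mult G (gel k0 k1 k2 k3) (gel l0 l1 l2 l3) =
    gel (k0 * l0) (k0 * l1 + k1 * l0) (k0 * l2 + k2 * l0) (k0 * l3 + k1 * l2 + k2 * l1 + k3 * l0)"
proof (rule eq_gelI)
  show "ga_mult G (gel k0 k1 k2 k3) (gel l0 l1 l2 l3) g = 0" if "g \<notin> G" for g
  proof -
    have "a \<circ> b \<noteq> g" if "a \<in> G" "b \<in> G" for a b using that \<open>g \<notin> G\<close> comp_G by blast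
    then show ?thesis by (simp add: ga_mult_def)
  qed
qed (simp_all add: ga_mult_def sum_G G_table algebra_simps)

lemma gel_add: "(\<lambda>g. gel a b c d g + gel a' b' c' d' g) = gel (a + a') (b + b') (c + c') (d + d')"
  by (rule eq_gelI) (simp_all add: algebra_simps gel_outside)

lemma gel_scale: "k * gel a b c d g = gel (k * a) (k * b) (k * c) (k * d) g"
  by (simp add: gel_def algebra_simps)

lemma gel_0: "gel 0 0 0 0 = (\<lambda>_. 0)"
  by (simp add: gel_def fun_eq_iff)

lemma gel_sum: "(\<lambda>g. \<Sum>i<(n::nat). gel (a i) (b i) (c i) (d i) g) =
    gel (\<Sum>i<n. a i) (\<Sum>i<n. b i) (\<Sum>i<n. c i) (\<Sum>i<n. d i)"
  by (induction n) (simp_all add: gel_0 gel_add[symmetric] fun_eq_iff)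

section \<open>The associated order and its exponents\<close>

definition "w1 = max (mA - mB) (mC - mD)"
definition "w2 = max (mA - mC) (mB - mD)"
definition "w3 = mA - mD"
definition "E = mA + mD - mB - mC"

definition GS where
  "GS n0 n1 n2 n3 = {gel k0 k1 k2 k3 | k0 k1 k2 k3. k0 \<in> Q n0 \<and> k1 \<in> Q n1 \<and> k2 \<in> Q n2 \<and> k3 \<in> Q n3}"

lemma gel_GS: "gel k0 k1 k2 k3 \<in> GS n0 n1 n2 n3 \<longleftrightarrow> k0 \<in> Q n0 \<and> k1 \<in> Q n1 \<and> k2 \<in> Q n2 \<and> k3 \<in> Q n3"
  by (auto simp: GS_def gel_eq_iff)

lemma GS_cases:
  assumes "\<alpha> \<in> GS n0 n1 n2 n3"
  obtains k0 k1 k2 k3 where "\<alpha> = gel k0 k1 k2 k3" "k0 \<in> Q n0" "k1 \<in> Q n1" "k2 \<in> Q n2" "k3 \<in> Q n3"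
  using assms by (auto simp: GS_def)

lemma zero_GS: "(\<lambda>_. 0) \<in> GS n0 n1 n2 n3"
  by (simp add: gel_GS flip: gel_0)

lemma GS_add: "\<alpha> \<in> GS n0 n1 n2 n3 \<Longrightarrow> \<beta> \<in> GS n0 n1 n2 n3 \<Longrightarrow> (\<lambda>g. \<alpha> g + \<beta> g) \<in> GS n0 n1 n2 n3"
  by (elim GS_cases) (auto simp: gel_add gel_GS intro: Q_add)

lemma GS_sum:
  "\<forall>i<n. \<alpha> i \<in> GS n0 n1 n2 n3 \<Longrightarrow> (\<lambda>g. \<Sum>i<(n::nat). \<alpha> i g) \<in> GS n0 n1 n2 n3"
proof (induction n)
  case (Suc n)
  then have "(\<lambda>g. (\<Sum>i<n. \<alpha> i g) + \<alpha> n g) \<in> GS n0 n1 n2 n3" by (intro GS_add) auto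
  then show ?case by simp
qed (simp add: zero_GS)

abbreviation "\<AA> \<equiv> assoc_order K v G h"

lemma assoc_order_eq: "\<AA> = GS 0 w1 w2 w3"
proof (rule set_eqI)
  fix \<alpha>
  have "gel k0 k1 k2 k3 \<in> \<AA> \<longleftrightarrow> k0 \<in> Q 0 \<and> k1 \<in> Q w1 \<and> k2 \<in> Q w2 \<and> k3 \<in> Q w3"
    if K: "k0 \<in> K" "k1 \<in> K" "k2 \<in> K" "k3 \<in> K" for k0 k1 k2 k3
  proof
    assume *: "gel k0 k1 k2 k3 \<in> \<AA>"
    have act: "k0 * a + k1 * b + k2 * c + k3 * d \<in> Q mA \<and> k0 * b + k2 * d \<in> Q mB \<and>
        k0 * c + k1 * d \<in> Q mC \<and> k0 * d \<in> Q mD"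
      if abcd: "a \<in> Q mA" "b \<in> Q mB" "c \<in> Q mC" "d \<in> Q mD" for a b c d
    proof -
      note abcd_K = abcd[THEN Q_K]
      have "ga_act G (gel k0 k1 k2 k3) (el a b c d) \<in> P h"
        using * abcd abcd_K by (auto simp: assoc_order_def el_P)
      then show ?thesis using K abcd_K by (simp add: gel_act el_P)
    qed
    \<comment> \<open>The tests are the leading multiples of \<open>x1\<close>, \<open>x2\<close>
      and \<open>x1 * x2\<close>; each conjunct of \<open>act\<close> then bounds a single
      coefficient.\<close>
    have "k1 \<in> Q (mA - mB)" "k2 \<in> Q (mA - mC)"
      using act[of 0 "p mB" 0 0] act[of 0 0 "p mC" 0] K by (simp_all add: p_Q Q_mult_p)
    moreover have "k3 \<in> Q w3" "k2 \<in> Q (mB - mD)" "k1 \<in> Q (mC - mD)" "k0 \<in> Q 0"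
      using act[of 0 0 0 "p mD"] K by (simp_all add: p_Q Q_mult_p w3_def)
    ultimately show "k0 \<in> Q 0 \<and> k1 \<in> Q w1 \<and> k2 \<in> Q w2 \<and> k3 \<in> Q w3"
      by (simp add: w1_def w2_def max_def)
  next
    assume k: "k0 \<in> Q 0 \<and> k1 \<in> Q w1 \<and> k2 \<in> Q w2 \<and> k3 \<in> Q w3"
    have "ga_act G (gel k0 k1 k2 k3) y \<in> P h" if y: "y \<in> P h" for y
    proof -
      obtain a b c d where abcd: "a \<in> Q mA" "b \<in> Q mB" "c \<in> Q mC" "d \<in> Q mD" "y = el a b c d"
        using el_P_cases[OF y] .
      note abcd_K = abcd(1-4)[THEN Q_K]
      have "k0 * a \<in> Q mA" "k0 * b \<in> Q mB" "k0 * c \<in> Q mC" "k0 * d \<in> Q mD"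
        using k abcd by (auto elim: Q_mult)
      moreover have "k1 * b \<in> Q mA" "k1 * d \<in> Q mC"
        using k abcd by (auto elim!: Q_mult simp: w1_def)
      moreover have "k2 * c \<in> Q mA" "k2 * d \<in> Q mB"
        using k abcd by (auto elim!: Q_mult simp: w2_def)
      moreover have "k3 * d \<in> Q mA"
        using k abcd by (auto elim!: Q_mult simp: w3_def)
      ultimately show ?thesis using abcd_K K abcd(5) by (simp add: gel_act el_P Q_add)
    qed
    then show "gel k0 k1 k2 k3 \<in> \<AA>" using K grpalg_iff by (auto simp: assoc_order_def)
  qed
  note * = this
  show "\<alpha> \<in> \<AA> \<longleftrightarrow> \<alpha> \<in> GS 0 w1 w2 w3"
  proof
    assume \<alpha>: "\<alpha> \<in> \<AA>"
    then obtain k0 k1 k2 k3 where "k0 \<in> K" "k1 \<in> K" "k2 \<in> K" "k3 \<in> K" "\<alpha> = gel k0 k1 k2 k3"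
      using grpalg_iff by (auto simp: assoc_order_def)
    with * \<alpha> show "\<alpha> \<in> GS 0 w1 w2 w3" by (simp add: gel_GS)
  next
    assume "\<alpha> \<in> GS 0 w1 w2 w3"
    then show "\<alpha> \<in> \<AA>" by (elim GS_cases) (simp add: * Q_K)
  qed
qed

lemma gel_assoc: "gel k0 k1 k2 k3 \<in> \<AA> \<longleftrightarrow> k0 \<in> Q 0 \<and> k1 \<in> Q w1 \<and> k2 \<in> Q w2 \<and> k3 \<in> Q w3"
  by (simp add: assoc_order_eq gel_GS)

lemma assoc_act: "\<alpha> \<in> \<AA> \<Longrightarrow> x \<in> P h \<Longrightarrow> ga_act G \<alpha> x \<in> P h"
  by (simp add: assoc_order_def)

lemma act_0: "ga_act G (\<lambda>_. 0) x = 0"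
  by (simp add: ga_act_def)

section \<open>Generators of the ideal and freeness\<close>

lemma generated_byI:
  assumes "set xs \<subseteq> P h"
    and "\<And>y. y \<in> P h \<Longrightarrow> \<exists>as. (\<forall>i<length xs. as i \<in> \<AA>) \<and> y = (\<Sum>i<length xs. ga_act G (as i) (xs ! i))"
  shows "generated_by G \<AA> (P h) xs"
  unfolding generated_by_def
proof (intro conjI assms(1) set_eqI iffI)
  fix y assume "y \<in> P h"
  with assms(2) show "y \<in> {\<Sum>i<length xs. ga_act G (as i) (xs ! i) |as. \<forall>i<length xs. as i \<in> \<AA>}"
    by blast
next
  fix y assume "y \<in> {\<Sum>i<length xs. ga_act G (as i) (xs ! i) |as. \<forall>i<length xs. as i \<in> \<AA>}"
  then obtain as where "\<forall>i<length xs. as i \<in> \<AA>" "y = (\<Sum>i<length xs. ga_act G (as i) (xs ! i))" by blast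
  then show "y \<in> P h"
    using assms(1) by (auto intro!: P_sum assoc_act)
qed

text \<open>For \<open>E \<le> 0\<close> the bounds coming from \<open>x1 * x2\<close> dominate:
  \<open>w1 = mC - mD\<close> and \<open>w2 = mB - mD\<close>. The order thus carries the leading
  multiple of \<open>x1 * x2\<close> onto those of all other monomials.\<close>

lemma free_if:
  assumes "E \<le> 0"
  shows "free_over G \<AA> (P h)"
  unfolding free_over_def
proof (intro exI conjI allI impI)
  let ?x = "el 0 0 0 (p mD)"
  have act: "ga_act G (gel k0 k1 k2 k3) ?x = el (k3 * p mD) (k2 * p mD) (k1 * p mD) (k0 * p mD)" for k0 k1 k2 k3
    by (simp add: gel_act)
  show "generated_by G \<AA> (P h) [?x]"
  proof (rule generated_byI)
    show "set [?x] \<subseteq> P h" by (simp add: el_P p_Q)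
    fix y assume "y \<in> P h"
    then obtain a b c d where abcd: "a \<in> Q mA" "b \<in> Q mB" "c \<in> Q mC" "d \<in> Q mD" "y = el a b c d"
      by (rule el_P_cases)
    have "gel (d / p mD) (c / p mD) (b / p mD) (a / p mD) \<in> \<AA>"
      using abcd assms by (auto simp: gel_assoc w1_def w2_def w3_def E_def elim!: Q_divide)
    moreover have "y = ga_act G (gel (d / p mD) (c / p mD) (b / p mD) (a / p mD)) ?x"
      by (simp add: act abcd)
    ultimately show "\<exists>as. (\<forall>i<length [?x]. as i \<in> \<AA>) \<and> y = (\<Sum>i<length [?x]. ga_act G (as i) ([?x] ! i))"
      by (intro exI[of _ "\<lambda>_. gel (d / p mD) (c / p mD) (b / p mD) (a / p mD)"]) simp
  qed
  fix as i
  assume as: "\<forall>i<length [?x]. as i \<in> \<AA>" "(\<Sum>i<length [?x]. ga_act G (as i) ([?x] ! i)) = 0" "i < length [?x]"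
  have "as 0 \<in> GS 0 w1 w2 w3" using as by (simp add: assoc_order_eq)
  then obtain k0 k1 k2 k3 where k: "as 0 = gel k0 k1 k2 k3" "k0 \<in> K" "k1 \<in> K" "k2 \<in> K" "k3 \<in> K"
    using Q_K by (metis GS_cases)
  have "ga_act G (as 0) ?x = 0" using as(2) by simp
  then have "el (k3 * p mD) (k2 * p mD) (k1 * p mD) (k0 * p mD) = 0" by (simp add: k(1) act)
  from el_eq_0[OF _ _ _ _ this] k show "as i = (\<lambda>_. 0)" using as(3) by (simp add: gel_0)
qed

text \<open>The monomial 1 needs no generator of its own: \<open>w3 = mA - mD\<close> lets
  \<open>\<Psi>1 \<Psi>2\<close> produce it from \<open>x1 * x2\<close>.\<close>

lemma gens_3:
  assumes "E > 0"
  shows "generated_by G \<AA> (P h) [el 0 0 0 (p mD), el 0 (p mB) 0 0, el 0 0 (p mC) 0]"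
    (is "generated_by G \<AA> (P h) ?xs")
proof (rule generated_byI)
  show "set ?xs \<subseteq> P h" by (simp add: el_P p_Q)
  fix y assume "y \<in> P h"
  then obtain a b c d where abcd: "a \<in> Q mA" "b \<in> Q mB" "c \<in> Q mC" "d \<in> Q mD" "y = el a b c d"
    by (rule el_P_cases)
  define as where "as = (!) [gel (d / p mD) 0 0 (a / p mD), gel (b / p mB) 0 0 0, gel (c / p mC) 0 0 0]"
  have "\<forall>i<length ?xs. as i \<in> \<AA>"
    using abcd by (auto simp: gel_assoc as_def less_Suc_eq w3_def elim!: Q_divide)
  moreover have "y = (\<Sum>i<length ?xs. ga_act G (as i) (?xs ! i))"
    by (simp add: as_def gel_act el_add abcd)
  ultimately show "\<exists>as. (\<forall>i<length ?xs. as i \<in> \<AA>) \<and> y = (\<Sum>i<length ?xs. ga_act G (as i) (?xs ! i))"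
    by blast
qed

text \<open>When \<open>E > 0\<close>, no positive-degree monomial of \<open>\<AA>\<close> reaches the leading coefficients
  at \<open>x1 * x2\<close>, \<open>x1\<close> and \<open>x2\<close>: they induce three independent functionals on \<open>P h / \<MM> (P h)\<close>.\<close>

lemma length_gens_ge:
  assumes gen: "generated_by G \<AA> (P h) xs" and E: "E > 0"
  shows "3 \<le> length xs"
proof -
  let ?n = "length xs"
  have xs: "xs ! i \<in> P h" if "i < ?n" for i
  proof -
    have "set xs \<subseteq> P h" using gen unfolding generated_by_def by blast
    then show ?thesis using that nth_mem by blast
  qed
  have "\<forall>i. \<exists>a b c d. i < ?n \<longrightarrow> a \<in> Q mA \<and> b \<in> Q mB \<and> c \<in> Q mC \<and> d \<in> Q mD \<and> xs ! i = el a b c d"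
    using el_P_cases[OF xs] by metis
  then obtain a b c d where x: "\<And>i. i < ?n \<Longrightarrow> a i \<in> Q mA \<and> b i \<in> Q mB \<and> c i \<in> Q mC \<and> d i \<in> Q mD
      \<and> xs ! i = el (a i) (b i) (c i) (d i)"
    by metis
  define f where "f i = (!) [d i / p mD, b i / p mB, c i / p mC]" for i
  have coeffs: "\<exists>k. (\<Sum>i<?n. k i * f i 0) + d' / p mD \<in> P 1 \<and>
      (\<Sum>i<?n. k i * f i 1) + b' / p mB \<in> P 1 \<and> (\<Sum>i<?n. k i * f i 2) + c' / p mC \<in> P 1"
    if y: "el 0 b' c' d' \<in> P h" and y_K: "b' \<in> K" "c' \<in> K" "d' \<in> K" for b' c' d'
  proof -
    obtain as where as: "\<forall>i<?n. as i \<in> \<AA>" "el 0 b' c' d' = (\<Sum>i<?n. ga_act G (as i) (xs ! i))"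
      using gen y unfolding generated_by_def by blast
    have "\<forall>i. \<exists>k0 k1 k2 k3. i < ?n \<longrightarrow> as i = gel k0 k1 k2 k3 \<and> k0 \<in> Q 0 \<and> k1 \<in> Q w1 \<and> k2 \<in> Q w2 \<and> k3 \<in> Q w3"
      using as(1) unfolding assoc_order_eq by (metis GS_cases)
    then obtain k0 k1 k2 k3 where k: "\<And>i. i < ?n \<Longrightarrow> as i = gel (k0 i) (k1 i) (k2 i) (k3 i) \<and>
        k0 i \<in> Q 0 \<and> k1 i \<in> Q w1 \<and> k2 i \<in> Q w2 \<and> k3 i \<in> Q w3"
      by metis
    define A where "A i = k0 i * a i + k1 i * b i + k2 i * c i + k3 i * d i" for i
    define B where "B i = k0 i * b i + k2 i * d i" for i
    define C where "C i = k0 i * c i + k1 i * d i" for i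
    define D where "D i = k0 i * d i" for i
    have in_K: "k0 i \<in> K" "k1 i \<in> K" "k2 i \<in> K" "k3 i \<in> K" "a i \<in> K" "b i \<in> K" "c i \<in> K" "d i \<in> K" if "i < ?n" for i
      using k[OF that] x[OF that] Q_K by blast+
    have ABCD_K: "A i \<in> K" "B i \<in> K" "C i \<in> K" "D i \<in> K" if "i < ?n" for i
      using in_K[OF that] by (simp_all add: A_def B_def C_def D_def)
    have el_sum: "(\<Sum>i<n. el (A i) (B i) (C i) (D i)) = el (\<Sum>i<n. A i) (\<Sum>i<n. B i) (\<Sum>i<n. C i) (\<Sum>i<n. D i)" for n :: nat
      by (induction n) (simp_all add: el_add, simp add: el_def)
    have "el 0 b' c' d' = (\<Sum>i<?n. el (A i) (B i) (C i) (D i))"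
      unfolding as(2) using k x in_K by (intro sum.cong) (simp_all add: gel_act A_def B_def C_def D_def)
    also note el_sum
    finally have el_eq: "el 0 b' c' d' = el (\<Sum>i<?n. A i) (\<Sum>i<?n. B i) (\<Sum>i<?n. C i) (\<Sum>i<?n. D i)" .
    have "(\<Sum>i<?n. A i) \<in> K" "(\<Sum>i<?n. B i) \<in> K" "(\<Sum>i<?n. C i) \<in> K" "(\<Sum>i<?n. D i) \<in> K"
      using ABCD_K by (auto intro!: subfield_sum[OF subK])
    from el_eq_iff[OF subfieldD(1)[OF subK] y_K this] el_eq have eq: "b' = (\<Sum>i<?n. B i)" "c' = (\<Sum>i<?n. C i)" "d' = (\<Sum>i<?n. D i)"
      by simp_all
    have "(\<Sum>i<?n. k0 i * f i 0) + d' / p mD = 0"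
      by (simp add: eq f_def D_def sum_divide_distrib)
    moreover have "(\<Sum>i<?n. k0 i * f i 1) + b' / p mB = (\<Sum>i<?n. k2 i * d i / p mB)"
      by (simp add: eq f_def B_def sum_divide_distrib add_divide_distrib sum.distrib)
    moreover have "(\<Sum>i<?n. k0 i * f i 2) + c' / p mC = (\<Sum>i<?n. k1 i * d i / p mC)"
      by (simp add: eq f_def C_def sum_divide_distrib add_divide_distrib sum.distrib)
    moreover have "(\<Sum>i<?n. k2 i * d i / p mB) \<in> Q 1" "(\<Sum>i<?n. k1 i * d i / p mC) \<in> Q 1"
    proof (safe intro!: Q_sum)
      fix i assume "i < ?n"
      \<comment> \<open>Here \<open>mA - mC + mD = mB + E\<close> and
        \<open>mA - mB + mD = mC + E\<close>, so both contributions vanish modulo the maximal ideal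
        once \<open>E\<close> is positive.\<close>
      then have "k2 i * d i \<in> Q (mA - mC + mD)" "k1 i * d i \<in> Q (mA - mB + mD)"
        using k[of i] x[of i] Q_mult[of "k2 i" w2 "d i" mD] Q_mult[of "k1 i" w1 "d i" mD]
        by (simp_all add: w1_def w2_def)
      then show "k2 i * d i / p mB \<in> Q 1" "k1 i * d i / p mC \<in> Q 1"
        using E by (auto elim!: Q_divide simp: E_def)
    qed
    ultimately show ?thesis by (intro exI[of _ k0]) (auto simp: Q_def elim: P_mono)
  qed
  obtain c0 where c0: "(\<Sum>i<?n. c0 i * f i 0) + 1 \<in> P 1" "(\<Sum>i<?n. c0 i * f i 1) \<in> P 1" "(\<Sum>i<?n. c0 i * f i 2) \<in> P 1"
    using coeffs[of 0 0 "p mD"] by (auto simp: el_P p_Q)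
  obtain c1 where c1: "(\<Sum>i<?n. c1 i * f i 0) \<in> P 1" "(\<Sum>i<?n. c1 i * f i 1) + 1 \<in> P 1" "(\<Sum>i<?n. c1 i * f i 2) \<in> P 1"
    using coeffs[of "p mB" 0 0] by (auto simp: el_P p_Q)
  obtain c2 where c2: "(\<Sum>i<?n. c2 i * f i 0) \<in> P 1" "(\<Sum>i<?n. c2 i * f i 1) \<in> P 1" "(\<Sum>i<?n. c2 i * f i 2) + 1 \<in> P 1"
    using coeffs[of 0 "p mC" 0] by (auto simp: el_P p_Q)
  show ?thesis
  proof (rule residue_rank_le[where c = "(!) [c0, c1, c2]" and f = f])
    fix j l :: nat assume "j < 3" "l < 3"
    then have "j = 0 \<or> j = 1 \<or> j = 2" "l = 0 \<or> l = 1 \<or> l = 2" by auto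
    then show "(\<Sum>i<?n. ([c0, c1, c2] ! j) i * f i l) + (if j = l then 1 else 0) \<in> P 1"
      using c0 c1 c2 by auto
  qed
qed

text \<open>Two vectors of \<open>L\<close> are dependent already over the socle \<open>K \<Psi>1 \<Psi>2\<close>.\<close>

lemma not_free_if:
  assumes "E > 0"
  shows "\<not> free_over G \<AA> (P h)"
proof
  assume "free_over G \<AA> (P h)"
  then obtain xs where gen: "generated_by G \<AA> (P h) xs"
    and indep: "\<And>as. (\<forall>i<length xs. as i \<in> \<AA>) \<Longrightarrow>
        (\<Sum>i<length xs. ga_act G (as i) (xs ! i)) = 0 \<Longrightarrow> \<forall>i<length xs. as i = (\<lambda>_. 0)"
    unfolding free_over_def by blast
  have len: "1 < length xs" using length_gens_ge[OF gen assms] by simp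
  have "set xs \<subseteq> P h" using gen unfolding generated_by_def by blast
  then have "xs ! i \<in> P h" if "i < length xs" for i using that nth_mem by blast
  with len have "xs ! 0 \<in> P h" "xs ! 1 \<in> P h" by (blast intro: less_trans[OF zero_less_one])+
  note xs_P = this
  obtain a0 b0 c0 d0
    where Q0: "a0 \<in> Q mA" "b0 \<in> Q mB" "c0 \<in> Q mC" "d0 \<in> Q mD" and xs0: "xs ! 0 = el a0 b0 c0 d0"
    using el_P_cases[OF xs_P(1)] .
  obtain a1 b1 c1 d1
    where Q1: "a1 \<in> Q mA" "b1 \<in> Q mB" "c1 \<in> Q mC" "d1 \<in> Q mD" and xs1: "xs ! 1 = el a1 b1 c1 d1"
    using el_P_cases[OF xs_P(2)] .
  note x = xs0 xs1 Q0 Q1 Q0[THEN Q_K] Q1[THEN Q_K]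
  have sum2: "(\<Sum>i<length xs. ga_act G (if i = 0 then \<alpha> else if i = 1 then \<beta> else (\<lambda>_. 0)) (xs ! i)) =
      ga_act G \<alpha> (xs ! 0) + ga_act G \<beta> (xs ! 1)" (is "?lhs = _") for \<alpha> \<beta>
  proof -
    have "?lhs = (\<Sum>i\<in>{0, 1}. ga_act G (if i = 0 then \<alpha> else if i = 1 then \<beta> else (\<lambda>_. 0)) (xs ! i))"
      using len by (intro sum.mono_neutral_right) (auto simp: act_0)
    then show ?thesis by simp
  qed
  have dep: "gel 0 0 0 k = (\<lambda>_. 0) \<and> gel 0 0 0 l = (\<lambda>_. 0)"
    if kl: "k \<in> Q w3" "l \<in> Q w3" "k * d0 + l * d1 = 0" for k l
  proof -
    let ?as = "\<lambda>i::nat. if i = 0 then gel 0 0 0 k else if i = 1 then gel 0 0 0 l else (\<lambda>_. 0)"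
    have "\<forall>i<length xs. ?as i \<in> \<AA>"
      using kl by (auto simp: gel_assoc) (simp add: assoc_order_eq zero_GS)
    moreover have "(\<Sum>i<length xs. ga_act G (?as i) (xs ! i)) = 0"
      unfolding sum2 using x kl by (simp add: gel_act el_add)
    ultimately have "\<forall>i<length xs. ?as i = (\<lambda>_. 0)" by (rule indep)
    then have "?as 0 = (\<lambda>_. 0)" "?as 1 = (\<lambda>_. 0)" using len by (blast intro: less_trans[OF zero_less_one])+
    then show ?thesis by simp
  qed
  \<comment> \<open>The relation \<open>d1 * d0 + d0 * d1 = 0\<close>, scaled so that its
    coefficients lie in the order; independence makes \<open>d0\<close> and \<open>d1\<close>
    vanish.\<close>
  have "d1 * p (w3 - mD) \<in> Q w3" "d0 * p (w3 - mD) \<in> Q w3"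
    using x p_Q[of "w3 - mD" "w3 - mD"] by (auto elim!: Q_mult)
  moreover have "d1 * p (w3 - mD) * d0 + d0 * p (w3 - mD) * d1 = 0" by (simp add: mult_ac)
  ultimately have "gel 0 0 0 (d1 * p (w3 - mD)) = (\<lambda>_. 0)" "gel 0 0 0 (d0 * p (w3 - mD)) = (\<lambda>_. 0)"
    using dep by blast+
  then have "d0 = 0" "d1 = 0" by (simp_all add: gel_eq_iff flip: gel_0)
  \<comment> \<open>Now \<open>\<Psi>1 \<Psi>2\<close> kills the first generator outright, so
    \<open>p w3\<close> gives a nontrivial relation.\<close>
  with dep[of "p w3" 0] show False by (simp add: gel_eq_iff p_Q flip: gel_0)
qed

lemma min_gens_eq_3:
  assumes "E > 0"
  shows "min_gens G \<AA> (P h) = 3"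
  unfolding min_gens_def
proof (rule Least_equality)
  show "\<exists>xs. length xs = 3 \<and> generated_by G \<AA> (P h) xs"
    using gens_3[OF assms] by (intro exI conjI[rotated]) auto
qed (use length_gens_ge[OF _ assms] in blast)

section \<open>The maximal ideal and its square\<close>

definition "\<MM> = GS 1 w1 w2 w3"

lemma w3_le: "w3 \<le> w1 + w2"
  by (simp add: w1_def w2_def w3_def max_def)

text \<open>More precisely, \<open>w1 + w2 - w3\<close> is the absolute value of \<open>E\<close>:
  both \<open>w1\<close> and \<open>w2\<close> exceed the bound coming from \<open>x1 * x2\<close>
  by \<open>max 0 E\<close>.\<close>

lemma w3_eq_iff: "w3 = w1 + w2 \<longleftrightarrow> E = 0"
  by (auto simp: w1_def w2_def w3_def E_def max_def)

lemma assoc_cases: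
  assumes "\<alpha> \<in> \<AA>"
  obtains k0 k1 k2 k3 where "\<alpha> = gel k0 k1 k2 k3" "k0 \<in> Q 0" "k1 \<in> Q w1" "k2 \<in> Q w2" "k3 \<in> Q w3"
  using assms by (auto simp: assoc_order_eq GS_def)

text \<open>The coefficient \<open>k0\<close> is the augmentation of the group algebra element;
  \<open>\<MM>\<close> consists of the elements of the order whose augmentation is not a
  unit.\<close>

lemma MM_ideal: "ga_ideal G \<AA> \<MM>"
  unfolding ga_ideal_def
proof (intro conjI ballI)
  show "\<MM> \<subseteq> \<AA>" by (auto simp: \<MM>_def assoc_order_eq GS_def elim: Q_mono) (metis Q_mono zero_le_one)
  show "(\<lambda>_. 0) \<in> \<MM>" by (simp add: \<MM>_def zero_GS)
  show "(\<lambda>\<sigma>. x \<sigma> + y \<sigma>) \<in> \<MM>" if "x \<in> \<MM>" "y \<in> \<MM>" for x y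
    using that by (simp add: \<MM>_def GS_add)
  show "ga_mult G a x \<in> \<MM>" if a: "a \<in> \<AA>" and x: "x \<in> \<MM>" for a x
  proof -
    obtain k0 k1 k2 k3 where k: "a = gel k0 k1 k2 k3" "k0 \<in> Q 0" "k1 \<in> Q w1" "k2 \<in> Q w2" "k3 \<in> Q w3"
      using a by (rule assoc_cases)
    obtain l0 l1 l2 l3 where l: "x = gel l0 l1 l2 l3" "l0 \<in> Q 1" "l1 \<in> Q w1" "l2 \<in> Q w2" "l3 \<in> Q w3"
      using x unfolding \<MM>_def by (rule GS_cases)
    show ?thesis unfolding k(1) l(1) gel_mult \<MM>_def gel_GS
      using k l w3_le by (auto intro!: Q_add elim!: Q_mult)
  qed
qed

text \<open>In characteristic two \<open>\<alpha>\<^sup>2\<close> is the scalar \<open>k0\<^sup>2\<close>, which inverts every \<open>\<alpha>\<close> with \<open>k0\<close> a unit.\<close>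

lemma proper_ideal_subset_MM:
  assumes J: "ga_ideal G \<AA> J" and "J \<noteq> \<AA>"
  shows "J \<subseteq> \<MM>"
proof
  fix \<alpha> assume \<alpha>: "\<alpha> \<in> J"
  with J have "\<alpha> \<in> \<AA>" by (auto simp: ga_ideal_def)
  then obtain k0 k1 k2 k3 where k: "\<alpha> = gel k0 k1 k2 k3" "k0 \<in> Q 0" "k1 \<in> Q w1" "k2 \<in> Q w2" "k3 \<in> Q w3"
    by (rule assoc_cases)
  show "\<alpha> \<in> \<MM>"
  proof (rule ccontr)
    assume "\<alpha> \<notin> \<MM>"
    then have "k0 \<notin> Q 1" using k by (simp add: \<MM>_def gel_GS)
    then have "k0 \<noteq> 0" by auto
    then have k0: "k0 \<noteq> 0" "v k0 < 4" "0 \<le> v k0" "k0 \<in> K"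
      using k(2) \<open>k0 \<notin> Q 1\<close> by (auto simp: Q_def P_iff)
    then have "4 dvd v k0" using K_dvd by blast
    with k0 have v0: "v k0 = 0" by presburger
    define r where "r = inverse (k0 * k0)"
    have r: "r \<in> Q 0" "r * (k0 * k0) = 1"
      using k0 v0 by (simp add: r_def Q_def P_iff v_mult v_inverse)
        (simp add: r_def k0(1) del: inverse_mult_distrib)
    have "gel (r * k0) (r * k1) (r * k2) (r * k3) \<in> \<AA>"
      using k r by (auto simp: gel_assoc elim!: Q_mult)
    then have "ga_mult G (gel (r * k0) (r * k1) (r * k2) (r * k3)) \<alpha> \<in> J"
      using J \<alpha> by (simp add: ga_ideal_def)
    also have "ga_mult G (gel (r * k0) (r * k1) (r * k2) (r * k3)) \<alpha> = gel 1 0 0 0"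
      using r(2) by (simp add: k(1) gel_mult gel_eq_iff mult_ac add_ac)
    finally have one: "gel 1 0 0 0 \<in> J" .
    have "\<beta> \<in> J" if "\<beta> \<in> \<AA>" for \<beta>
    proof -
      have "ga_mult G \<beta> (gel 1 0 0 0) \<in> J" using J one that by (simp add: ga_ideal_def)
      with that show ?thesis by (elim assoc_cases) (simp add: gel_mult)
    qed
    with J \<open>J \<noteq> \<AA>\<close> show False by (auto simp: ga_ideal_def)
  qed
qed

lemma MM_neq: "\<MM> \<noteq> \<AA>"
proof -
  have "gel 1 0 0 0 \<in> \<AA>" "gel 1 0 0 0 \<notin> \<MM>"
    by (simp_all add: gel_assoc \<MM>_def gel_GS) (simp_all add: Q_def P_iff)
  then show ?thesis by blast
qed

lemma the_max_ideal_eq: "the_max_ideal G \<AA> = \<MM>"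
  unfolding the_max_ideal_def
proof (rule the_equality)
  show "ga_maximal_ideal G \<AA> \<MM>"
    using MM_ideal MM_neq proper_ideal_subset_MM unfolding ga_maximal_ideal_def by blast
  show "I = \<MM>" if "ga_maximal_ideal G \<AA> I" for I
    using that MM_ideal MM_neq proper_ideal_subset_MM[of I] unfolding ga_maximal_ideal_def by metis
qed

text \<open>Only the \<open>\<Psi>1 \<Psi>2\<close> component arises in two ways: from a nonunit
  scalar, giving \<open>w3 + 1\<close>, or from a \<open>\<Psi>1\<close> term times a
  \<open>\<Psi>2\<close> term, giving \<open>w1 + w2\<close>.\<close>

lemma ideal_square_eq: "ideal_square G \<MM> = GS 2 (w1 + 1) (w2 + 1) (min (w3 + 1) (w1 + w2))"
  (is "_ = ?S")
proof (rule set_eqI, rule iffI)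
  fix \<alpha> assume "\<alpha> \<in> ideal_square G \<MM>"
  then obtain n a b where \<alpha>: "\<alpha> = (\<lambda>g. \<Sum>i<(n::nat). ga_mult G (a i) (b i) g)"
      "\<forall>i<n. a i \<in> \<MM> \<and> b i \<in> \<MM>"
    unfolding ideal_square_def by blast
  have "ga_mult G x y \<in> ?S" if x: "x \<in> \<MM>" and y: "y \<in> \<MM>" for x y
  proof -
    obtain k0 k1 k2 k3 where k: "x = gel k0 k1 k2 k3" "k0 \<in> Q 1" "k1 \<in> Q w1" "k2 \<in> Q w2" "k3 \<in> Q w3"
      using x unfolding \<MM>_def by (rule GS_cases)
    obtain l0 l1 l2 l3 where l: "y = gel l0 l1 l2 l3" "l0 \<in> Q 1" "l1 \<in> Q w1" "l2 \<in> Q w2" "l3 \<in> Q w3"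
      using y unfolding \<MM>_def by (rule GS_cases)
    show ?thesis unfolding k(1) l(1) gel_mult gel_GS
      using k l by (auto intro!: Q_add elim!: Q_mult)
  qed
  then show "\<alpha> \<in> ?S" unfolding \<alpha>(1) using \<alpha>(2) by (intro GS_sum) simp
next
  fix \<alpha> assume "\<alpha> \<in> ?S"
  then obtain k0 k1 k2 k3 where k: "\<alpha> = gel k0 k1 k2 k3" "k0 \<in> Q 2" "k1 \<in> Q (w1 + 1)" "k2 \<in> Q (w2 + 1)"
      "k3 \<in> Q (min (w3 + 1) (w1 + w2))"
    by (rule GS_cases)
  obtain s t where st: "k3 = s + t" "s \<in> Q (w3 + 1)" "t \<in> Q (w1 + w2)"
  proof (cases "w3 + 1 \<le> w1 + w2")
    case True
    with k(5) show ?thesis by (intro that[of k3 0]) (simp_all add: min_def)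
  next
    case False
    with k(5) show ?thesis by (intro that[of 0 k3]) (simp_all add: min_def)
  qed
  \<comment> \<open>Two products suffice: the scalar \<open>p 1\<close> accounts for everything but
    \<open>t\<close>, and a \<open>\<Psi>1\<close> term times a \<open>\<Psi>2\<close> term yields
    \<open>t\<close>.\<close>
  define a where "a = (!) [gel (p 1) 0 0 0, gel 0 (p w1) 0 0]"
  define b where "b = (!) [gel (k0 / p 1) (k1 / p 1) (k2 / p 1) (s / p 1), gel 0 0 (t / p w1) 0]"
  have "\<forall>i<2. a i \<in> \<MM> \<and> b i \<in> \<MM>"
    using k st by (auto simp: a_def b_def less_2_cases_iff \<MM>_def gel_GS p_Q elim!: Q_divide)
  moreover have "\<alpha> = (\<lambda>g. \<Sum>i<2. ga_mult G (a i) (b i) g)"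
    by (simp add: a_def b_def numeral_2_eq_2 gel_mult gel_add k(1) st(1))
  ultimately show "\<alpha> \<in> ideal_square G \<MM>" unfolding ideal_square_def by blast
qed

section \<open>The embedding dimension\<close>

definition "wt = (!) [1, w1, w2, w3]"

definition gelv where "gelv k = gel (k 0) (k 1) (k 2) (k (3::nat))"

lemma all_less_3: "(\<forall>l<3. R l) \<longleftrightarrow> R 0 \<and> R 1 \<and> R (2::nat)"
  and all_less_4: "(\<forall>l<4. R l) \<longleftrightarrow> R 0 \<and> R 1 \<and> R 2 \<and> R (3::nat)"
  by (simp_all add: numeral_eq_Suc All_less_Suc2)

lemma gelv_GS: "gelv k \<in> GS n0 n1 n2 n3 \<longleftrightarrow> (\<forall>l<4. k l \<in> Q (([n0, n1, n2, n3]) ! l))"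
  by (simp add: gelv_def gel_GS all_less_4)

lemma MM_gelv: "gelv k \<in> \<MM> \<longleftrightarrow> (\<forall>l<4. k l \<in> Q (wt l))"
  by (simp add: \<MM>_def gelv_GS wt_def)

lemma MM_cases:
  assumes "\<alpha> \<in> \<MM>"
  obtains k where "\<alpha> = gelv k" "\<forall>l<4. k l \<in> Q (wt l)"
proof -
  obtain k0 k1 k2 k3 where "\<alpha> = gel k0 k1 k2 k3"
    using assms unfolding \<MM>_def by (rule GS_cases)
  then have "\<alpha> = gelv ((!) [k0, k1, k2, k3])" by (simp add: gelv_def)
  with assms that show ?thesis by (simp add: MM_gelv)
qed

definition "dimM = (if E = 0 then 3 else 4 :: nat)"

text \<open>In this form the first \<open>dimM\<close> coordinates obey the same strict condition in
  both cases; for \<open>E = 0\<close> the last one is restricted no further than in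
  \<open>\<MM>\<close>.\<close>

lemma square_gelv:
  "gelv k \<in> ideal_square G \<MM> \<longleftrightarrow> (\<forall>l<dimM. k l \<in> Q (wt l + 1)) \<and> k 3 \<in> Q (if E = 0 then w3 else w3 + 1)"
proof -
  have "min (w3 + 1) (w1 + w2) = (if E = 0 then w3 else w3 + 1)"
    using w3_le w3_eq_iff by auto
  then show ?thesis
    by (cases "E = 0") (auto simp: ideal_square_eq gelv_GS all_less_3 all_less_4 wt_def dimM_def)
qed

lemma gelv_residue:
  fixes n :: nat
  shows "(\<lambda>g. gelv k g - (\<Sum>i<n. c i * gelv (\<kappa> i) g)) = gelv (\<lambda>l. k l + (\<Sum>i<n. c i * \<kappa> i l))"
proof -
  have "(\<lambda>g. \<Sum>i<n. c i * gelv (\<kappa> i) g) = gelv (\<lambda>l. \<Sum>i<n. c i * \<kappa> i l)"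
    unfolding gelv_def gel_scale by (rule gel_sum)
  then show ?thesis by (simp add: gelv_def gel_add[symmetric] fun_eq_iff)
qed

lemma emb_dim_eq: "emb_dim K v G \<AA> = dimM"
  unfolding emb_dim_def Let_def the_max_ideal_eq
proof (rule Least_equality)
  define ms where "ms i = gelv (\<lambda>l. if l = i then p (wt l) else 0)" for i
  have "ms i \<in> \<MM>" for i
    by (simp add: ms_def MM_gelv p_Q)
  moreover have "\<exists>c. (\<forall>i<dimM. c i \<in> K \<inter> P 0) \<and>
      (\<lambda>g. m g - (\<Sum>i<dimM. c i * ms i g)) \<in> ideal_square G \<MM>" if m: "m \<in> \<MM>" for m
  proof -
    obtain k where k: "m = gelv k" "\<forall>l<4. k l \<in> Q (wt l)" using m by (rule MM_cases)
    have eq: "k l + (\<Sum>i<dimM. k i / p (wt i) * (if l = i then p (wt l) else 0)) =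
        (if l < dimM then 0 else k l)" for l
    proof -
      have "(\<Sum>i<dimM. k i / p (wt i) * (if l = i then p (wt l) else 0)) =
          (\<Sum>i<dimM. if l = i then k i else 0)"
        by (rule sum.cong) auto
      then show ?thesis by simp
    qed
    have "(\<lambda>g. m g - (\<Sum>i<dimM. k i / p (wt i) * ms i g)) = gelv (\<lambda>l. if l < dimM then 0 else k l)"
      unfolding k(1) ms_def gelv_residue eq ..
    also have "\<dots> \<in> ideal_square G \<MM>"
      using k(2) by (auto simp: square_gelv dimM_def wt_def all_less_4)
    finally have "(\<lambda>g. m g - (\<Sum>i<dimM. k i / p (wt i) * ms i g)) \<in> ideal_square G \<MM>" .
    moreover have "k i / p (wt i) \<in> K \<inter> P 0" if "i < dimM" for i
      using k(2) that Q_divide[of "k i" "wt i" 0 "wt i"] by (auto simp: Q_def dimM_def split: if_splits)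
    ultimately show ?thesis by (intro exI[of _ "\<lambda>i. k i / p (wt i)"]) simp
  qed
  ultimately show "\<exists>ms. (\<forall>i<dimM. ms i \<in> \<MM>) \<and> (\<forall>m\<in>\<MM>. \<exists>c. (\<forall>i<dimM. c i \<in> K \<inter> P 0) \<and>
      (\<lambda>g. m g - (\<Sum>i<dimM. c i * ms i g)) \<in> ideal_square G \<MM>)" by blast
next
  fix n :: nat
  assume "\<exists>ms. (\<forall>i<n. ms i \<in> \<MM>) \<and> (\<forall>m\<in>\<MM>. \<exists>c. (\<forall>i<n. c i \<in> K \<inter> P 0) \<and>
      (\<lambda>g. m g - (\<Sum>i<n. c i * ms i g)) \<in> ideal_square G \<MM>)"
  then obtain ms where ms: "\<And>i. i < n \<Longrightarrow> ms i \<in> \<MM>"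
    and ms_span: "\<And>m. m \<in> \<MM> \<Longrightarrow> \<exists>c. (\<lambda>g. m g - (\<Sum>i<n. c i * ms i g)) \<in> ideal_square G \<MM>"
    by blast
  obtain \<kappa> where \<kappa>: "\<And>i. i < n \<Longrightarrow> ms i = gelv (\<kappa> i)"
  proof -
    have "\<exists>k. ms i = gelv k" if "i < n" for i
      using ms[OF that] by (rule MM_cases) blast
    with that show ?thesis by metis
  qed
  \<comment> \<open>Row \<open>j\<close> expresses the leading multiple of the \<open>j\<close>-th
    monomial through the \<open>ms i\<close>. Divided by \<open>p (wt l)\<close>, the rows form a
    matrix congruent to the identity.\<close>
  have "\<exists>c. \<forall>l<dimM. (if j = l then p (wt l) else 0) + (\<Sum>i<n. c i * \<kappa> i l) \<in> Q (wt l + 1)" for j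
  proof -
    let ?k = "\<lambda>l. if j = l then p (wt l) else 0"
    have "gelv ?k \<in> \<MM>" by (simp add: MM_gelv p_Q)
    from ms_span[OF this] obtain c where
      "(\<lambda>g. gelv ?k g - (\<Sum>i<n. c i * ms i g)) \<in> ideal_square G \<MM>" by blast
    also have "(\<lambda>g. gelv ?k g - (\<Sum>i<n. c i * ms i g)) = (\<lambda>g. gelv ?k g - (\<Sum>i<n. c i * gelv (\<kappa> i) g))"
      using \<kappa> by simp
    finally show ?thesis unfolding gelv_residue square_gelv by blast
  qed
  then obtain c where c: "\<And>j l. l < dimM \<Longrightarrow>
      (if j = l then p (wt l) else 0) + (\<Sum>i<n. c j i * \<kappa> i l) \<in> Q (wt l + 1)"
    by metis
  show "dimM \<le> n"
  proof (rule residue_rank_le[where c = c and f = "\<lambda>i l. \<kappa> i l / p (wt l)"])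
    fix j l assume "l < dimM"
    from Q_divide[OF c[OF this, of j], of 1 "wt l"]
    have "((if j = l then p (wt l) else 0) + (\<Sum>i<n. c j i * \<kappa> i l)) / p (wt l) \<in> P 1"
      by (auto simp: Q_def intro: P_mono[of _ 4])
    also have "((if j = l then p (wt l) else 0) + (\<Sum>i<n. c j i * \<kappa> i l)) / p (wt l) =
        (\<Sum>i<n. c j i * (\<kappa> i l / p (wt l))) + (if j = l then 1 else 0)"
      by (simp add: add_divide_distrib sum_divide_distrib add.commute)
    finally show "(\<Sum>i<n. c j i * (\<kappa> i l / p (wt l))) + (if j = l then 1 else 0) \<in> P 1" .
  qed
qed

section \<open>Arithmetic of the exponents modulo 4\<close>

lemma ceiling_div_4:
  fixes m x :: int
  assumes "4 * m - 4 < - x" "- x \<le> 4 * m"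
  shows "- (x div 4) = m"
  using assms by presburger

text \<open>The quotients by 4 cancel in \<open>E\<close>. For \<open>h mod 4\<close> equal to 0, 1,
  2, 3 its values are -1, 0, 1, 0 if \<open>- v x2\<close> is 1 modulo 4, and 0, 1, 0, -1 if it is 3
  modulo 4.\<close>

lemma E_cases:
  shows "E \<le> 0 \<longleftrightarrow> (- v x2) mod 4 = 1 \<and> h mod 4 \<noteq> 2 \<or> (- v x2) mod 4 = 3 \<and> h mod 4 \<noteq> 1"
    and "E = 0 \<longleftrightarrow> (- v x2) mod 4 = 1 \<and> h mod 2 = 1 \<or> (- v x2) mod 4 = 3 \<and> h mod 2 = 0"
proof -
  define i j q r s where "i = v x1 div 4" and "j = v x2 div 4" and "q = h div 4"
    and "r = v x2 mod 4" and "s = h mod 4"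
  have i: "v x1 = 4 * i + 2" using v_x1 by (simp add: i_def) presburger
  have j: "v x2 = 4 * j + r" and q: "h = 4 * q + s" by (simp_all add: j_def r_def q_def s_def)
  have r: "r = 1 \<or> r = 3" using v_x2 unfolding r_def by presburger
  have s: "s = 0 \<or> s = 1 \<or> s = 2 \<or> s = 3" unfolding s_def by presburger
  have "mA = q + (if s \<le> 0 then 0 else 1)" "mB = q - i + (if s \<le> 2 then 0 else 1)"
    "mC = q - j + (if s \<le> r then 0 else 1)" "mD = q - i - j + (if s \<le> r - 2 then -1 else 0)"
    unfolding mA_def mB_def mC_def mD_def using i j q r s
    by (intro ceiling_div_4; auto)+
  then have E: "E = (if s \<le> 0 then 0 else 1) - (if s \<le> 2 then 0 else 1) - (if s \<le> r then 0 else 1)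
      + (if s \<le> r - 2 then -1 else 0)"
    by (simp add: E_def)
  have mods: "(- v x2) mod 4 = 4 - r" "h mod 4 = s" "h mod 2 = s mod 2"
    using r unfolding s_def r_def by presburger+
  show "E \<le> 0 \<longleftrightarrow> (- v x2) mod 4 = 1 \<and> h mod 4 \<noteq> 2 \<or> (- v x2) mod 4 = 3 \<and> h mod 4 \<noteq> 1"
    "E = 0 \<longleftrightarrow> (- v x2) mod 4 = 1 \<and> h mod 2 = 1 \<or> (- v x2) mod 4 = 3 \<and> h mod 2 = 0"
    unfolding mods E using r s by auto
qed

end

theorem theorem4p4:
  fixes K :: "'a::field set" and v :: "'a \<Rightarrow> int" and G :: "('a \<Rightarrow> 'a) set" and h :: int
  assumes char2: "(2::'a) = 0"
    and val: "normalized_dval v"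
    and subK: "subfield K"
    and compl: "complete_in v K"
    and perf: "perfect_residue_char2 v K"
    and gal: "galois_with_group K G"
    and klein: "klein4 G"
    and totram: "totally_ramified4 v K"
  shows "(free_over G (assoc_order K v G h) (Pideal v h) \<longleftrightarrow>
            (lower_break v G 1 mod 4 = 1 \<and> h mod 4 \<noteq> 2) \<or>
            (lower_break v G 1 mod 4 = 3 \<and> h mod 4 \<noteq> 1))
       \<and> (\<not> free_over G (assoc_order K v G h) (Pideal v h) \<longrightarrow>
            min_gens G (assoc_order K v G h) (Pideal v h) = 3)
       \<and> emb_dim K v G (assoc_order K v G h) =
            (if (lower_break v G 1 mod 4 = 1 \<and> h mod 2 = 1) \<or>
                (lower_break v G 1 mod 4 = 3 \<and> h mod 2 = 0) then 3 else 4)"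
proof -
  interpret biquadratic v K G
    by unfold_locales (fact assms)+
  obtain \<tau> where \<tau>: "\<tau> \<in> G" "\<tau> \<noteq> id" "\<And>j. \<tau> \<in> ramgrp v G j \<longleftrightarrow> j \<le> lower_break v G 1"
    by (rule exists_first_break) blast
  obtain \<sigma> where \<sigma>: "\<sigma> \<in> G" "\<sigma> \<noteq> id" "\<sigma> \<noteq> \<tau>" using exists_other[OF \<tau>(1)] .
  obtain x1 x2 \<mu> where b:
    "\<sigma> x1 = x1 + 1" "\<tau> x1 = x1" "\<sigma> x2 = x2 + \<mu>" "\<tau> x2 = x2 + 1" "\<mu> \<in> K"
    "v x1 mod 4 = 2" "odd (v x2)"
    "\<And>y. \<exists>a\<in>K. \<exists>b\<in>K. \<exists>c\<in>K. \<exists>d\<in>K. y = a + b * x1 + c * x2 + d * x1 * x2"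
    "\<And>j. \<tau> \<in> ramgrp v G j \<longleftrightarrow> j \<le> - v x2"
    using exists_basis[OF \<sigma>(1) \<tau>(1) \<sigma>(2) \<tau>(2) \<sigma>(3)] by blast
  interpret adapted_basis v K G \<sigma> \<tau> x1 x2 \<mu> h
    by unfold_locales (use \<sigma> \<tau> b in auto)
  \<comment> \<open>Both numbers are the largest \<open>j\<close> for which
    \<open>ramgrp v G j\<close> contains \<open>\<tau>\<close>.\<close>
  have lb: "lower_break v G 1 = - v x2"
    using \<tau>(3) b(9) by (metis order.antisym order.refl)
  have free: "free_over G \<AA> (P h) \<longleftrightarrow> E \<le> 0"
    using free_if not_free_if by (meson not_le)
  show ?thesis
  proof (intro conjI impI)
    show "min_gens G \<AA> (P h) = 3" if "\<not> free_over G \<AA> (P h)"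
      using that min_gens_eq_3 free by simp
  qed (simp_all only: free lb emb_dim_eq dimM_def E_cases)
qed

end
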